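(* Let $a\ge1$ be an integer, $b=\lfloor\log_2 a\rfloor+1$, and let $K_a$ and the cosets $C_0^{(a)},\dots,C_{2^b-1}^{(a)}$ of $S$ in $\mathbb{F}_2^a\cong Z_{2^a}$ be as in the context. For $i=0,\dots,2^b-1$ let $B_i$ be the $2^{a-b}\times 2^a$ matrix formed by the rows of $K_a$ indexed by the elements of $C_i^{(a)}$, let $H$ be any Hadamard matrix of order $2^{a-b}$, let $\widetilde B_i=HB_i$, and let $$L_a=2^{-\frac{a-b}{2}}\begin{pmatrix}\widetilde B_0\\ \widetilde B_1\\ \vdots\\ \widetilde B_{2^b-1}\end{pmatrix}.$$ Then $L_a$ is a $2^a\times 2^a$ coordinate interleaved scaled complex orthogonal design (CIS-COD) in the $a+1$ complex variables $x_1,\dots,x_{a+1}$ (so of rate $(a+1)/2^a$), i.e. in particular $L_a^{\mathcal H}L_a=(|x_1|^2+\cdots+|x_{a+1}|^2)I_{2^a}$, and no entry of $L_a$ is (identically) zero.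
   Context: Rows and columns are indexed by $Z_{2^a}=\{0,\dots,2^a-1\}$, identified with $\mathbb{F}_2^a$ via binary expansion; $\oplus$ is bitwise XOR, $\|x\|$ the Hamming weight. $^*$ is complex conjugation, $^{\mathcal H}$ conjugate transpose, $\otimes$ Kronecker product. $G_a$: $G_1=\begin{pmatrix} x_1 & -x_2^*\\ x_2 & x_1^*\end{pmatrix}$, and for $a\ge2$, $G_a=\begin{pmatrix} G_{a-1} & -x_{a+1}^* I_{2^{a-1}}\\ x_{a+1} I_{2^{a-1}} & G_{a-1}^{\mathcal H}\end{pmatrix}$. $K_a$: let $m=2^b-a-1$, $H_2=\begin{pmatrix}1&1\\-1&1\end{pmatrix}$; for $i\in\{0,\dots,2^m-1\}$ let $A_i=I_{2^{a-m}}$ if $\|i\|$ is even and $A_i=I_{2^{a-m-1}}\otimes\tfrac1{\sqrt2}H_2$ if $\|i\|$ is odd; $W_a=\mathrm{diag}(A_0,\dots,A_{2^m-1})$; $K_a=W_aG_aW_a$. $S$: Let $M_a=\{0<x\le a: x \text{ not a power of } 2\}$, each $x\in M_a$ written $x=\sum_{j=0}^{b-1}x_j2^j$, $x_j\in\{0,1\}$. Define $g(x)=2x$ if $x_{b-1}=0$ and $g(x)=2x+1-2^b$ if $x_{b-1}=1$; let $\tilde M_a=g(M_a)$ and $H_a=\tilde M_a\setminus M_a$. Define $f':\tilde M_a\to M_a$ by $f'(x)=x$ if $x\in M_a\cap\tilde M_a$ and $f'(x)=x+1-2\lceil m/2\rceil$ if $x\in H_a$, and $f=f'\circ g$. Define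 $h(x)=2^{f(x)-1}+\sum_{j=0}^{b-2}x_j2^{2^{j+1}-1}+x_{b-1}$ for $x\in M_a$, let $M_a'=\{h(x):x\in M_a\}$, and let $S$ be the $\mathbb{F}_2$-linear span of $M_a'$ in $\mathbb{F}_2^a$ (dimension $a-b$); $C_0^{(a)},\dots,C_{2^b-1}^{(a)}$ are its $2^b$ cosets. Coordinate interleaved variables: for $x_i=x_{iI}+jx_{iQ}$, $x_k=x_{kI}+jx_{kQ}$ (real and imaginary parts, $j=\sqrt{-1}$), $x_{i,k}=x_{iI}+jx_{kQ}$. A CIS-COD in $x_1,\dots,x_k$ is a matrix $G$ with $G^{\mathcal H}G=(|x_1|^2+\cdots+|x_k|^2)I$ each of whose nonzero entries is a variable or coordinate interleaved variable, or a complex conjugate of these, multiplied by $\pm1/\sqrt{\lambda}$ for some power of two $\lambda$. *)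

theory Defs
  imports Complex_Main
begin

text \<open>A design is a matrix (indexed by naturals, only indices below the stated
 dimensions matter) whose entries are functions of the complex variables
 x 1, x 2, ... (an assignment x :: nat \<Rightarrow> complex).\<close>
type_synonym design = "nat \<Rightarrow> nat \<Rightarrow> (nat \<Rightarrow> complex) \<Rightarrow> complex"

text \<open>The complex orthogonal design G_a (G_0 = [x_1] makes G_1 fit the recursion).\<close>
fun Gdes :: "nat \<Rightarrow> design" where
  "Gdes 0 r c x = x 1"
| "Gdes (Suc a) r c x =
     (let h = 2 ^ a in
      if r < h \<and> c < h then Gdes a r c x
      else if r < h then (if r = c - h then - cnj (x (a + 2)) else 0)
      else if c < h then (if r - h = c then x (a + 2) else 0)
      else cnj (Gdes a (c - h) (r - h) x))"

fun hw :: "nat \<Rightarrow> nat" where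
  "hw n = (if n = 0 then 0 else n mod 2 + hw (n div 2))"

definition bpar :: "nat \<Rightarrow> nat" where
  "bpar a = nat \<lfloor>log 2 (real a)\<rfloor> + 1"

definition mpar :: "nat \<Rightarrow> nat" where
  "mpar a = 2 ^ bpar a - a - 1"

definition Wmat :: "nat \<Rightarrow> nat \<Rightarrow> nat \<Rightarrow> real" where
  "Wmat a r c =
     (let N = 2 ^ (a - mpar a); i = r div N; r' = r mod N; c' = c mod N in
      if r div N \<noteq> c div N then 0
      else if even (hw i) then (if r' = c' then 1 else 0)
      else if r' div 2 \<noteq> c' div 2 then 0
      else (if r' mod 2 = 1 \<and> c' mod 2 = 0 then -1 else 1) / sqrt 2)"

definition Kdes :: "nat \<Rightarrow> design" where
  "Kdes a r c x = (\<Sum>s<2^a. \<Sum>t<2^a.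
      complex_of_real (Wmat a r s) * Gdes a s t x * complex_of_real (Wmat a t c))"

definition digit :: "nat \<Rightarrow> nat \<Rightarrow> nat" where
  "digit x j = (x div 2 ^ j) mod 2"

definition Mset :: "nat \<Rightarrow> nat set" where
  "Mset a = {x. 0 < x \<and> x \<le> a \<and> \<not> (\<exists>j. x = 2 ^ j)}"

definition gmap :: "nat \<Rightarrow> nat \<Rightarrow> nat" where
  "gmap a x = (if digit x (bpar a - 1) = 0 then 2 * x else 2 * x + 1 - 2 ^ bpar a)"

definition fprime :: "nat \<Rightarrow> nat \<Rightarrow> nat" where
  "fprime a x = (if x \<in> Mset a \<inter> gmap a ` Mset a then x
                 else x + 1 - 2 * ((mpar a + 1) div 2))"

definition fmap :: "nat \<Rightarrow> nat \<Rightarrow> nat" where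
  "fmap a x = fprime a (gmap a x)"

definition hmap :: "nat \<Rightarrow> nat \<Rightarrow> nat" where
  "hmap a x = 2 ^ (fmap a x - 1)
     + (\<Sum>j<bpar a - 1. digit x j * 2 ^ (2 ^ (j + 1) - 1))
     + digit x (bpar a - 1)"

text \<open>F_2-linear span (under bitwise XOR) of a set of integers viewed as bit vectors.\<close>
inductive_set xor_span :: "nat set \<Rightarrow> nat set" for A where
  zero: "0 \<in> xor_span A"
| step: "v \<in> A \<Longrightarrow> s \<in> xor_span A \<Longrightarrow> xor v s \<in> xor_span A"

definition Sspace :: "nat \<Rightarrow> nat set" where
  "Sspace a = xor_span (hmap a ` Mset a)"

definition cosets :: "nat \<Rightarrow> nat set set" where
  "cosets a = {(\<lambda>s. xor y s) ` Sspace a | y. y < 2 ^ a}"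

definition hadamard :: "nat \<Rightarrow> (nat \<Rightarrow> nat \<Rightarrow> real) \<Rightarrow> bool" where
  "hadamard n H \<longleftrightarrow> (\<forall>i<n. \<forall>j<n. H i j = 1 \<or> H i j = -1) \<and>
     (\<forall>i<n. \<forall>j<n. (\<Sum>k<n. H i k * H j k) = (if i = j then real n else 0))"

text \<open>Admissible entries: \<plusminus> (1/sqrt lambda) times a variable x_i, a coordinate interleaved
 variable x_{i,k} = Re x_i + j Im x_k (x_{i,i} = x_i), or the conjugate of one of these,
 with i,k among 1..nv and lambda = 2^e a power of two.\<close>
definition cis_entry :: "nat \<Rightarrow> ((nat \<Rightarrow> complex) \<Rightarrow> complex) \<Rightarrow> bool" where
  "cis_entry nv e \<longleftrightarrow> (\<exists>i k s l cj. i \<in> {1..nv} \<and> k \<in> {1..nv} \<and> (s = 1 \<or> s = -1) \<and>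
     (\<forall>x. e x = complex_of_real (s / sqrt (2 ^ l)) *
        (if cj then cnj (Complex (Re (x i)) (Im (x k))) else Complex (Re (x i)) (Im (x k)))))"

definition cis_cod :: "nat \<Rightarrow> nat \<Rightarrow> nat \<Rightarrow> design \<Rightarrow> bool" where
  "cis_cod p n nv D \<longleftrightarrow>
     (\<forall>x. \<forall>i<n. \<forall>j<n. (\<Sum>k<p. cnj (D k i x) * D k j x) =
        (if i = j then complex_of_real (\<Sum>l\<in>{1..nv}. (cmod (x l))\<^sup>2) else 0)) \<and>
     (\<forall>r<p. \<forall>c<n. D r c = (\<lambda>x. 0) \<or> cis_entry nv (D r c))"

text \<open>L_a, given the coset enumeration C, enumerations rho i of the rows in each coset,
 and the Hadamard matrix H of order 2^(a-b). Row i*2^(a-b)+p is row p of H B_i.\<close>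
definition Ldes :: "nat \<Rightarrow> (nat \<Rightarrow> nat \<Rightarrow> nat) \<Rightarrow> (nat \<Rightarrow> nat \<Rightarrow> real) \<Rightarrow> design" where
  "Ldes a rho H r c x =
     (let N = 2 ^ (a - bpar a) in
      complex_of_real (1 / sqrt (2 ^ (a - bpar a))) *
      (\<Sum>q<N. complex_of_real (H (r mod N) q) * Kdes a (rho (r div N) q) c x))"

end

(* Label the unit vector e_(y-1) by y if y is even or y <= a - m, and by y - 1 + 2 ceil(m/2)
   otherwise; the syndrome of a bit vector is the XOR of the labels of its bits. The vector h(x)
   consists of e_(f(x)-1), whose label is g(x), and of unit vectors at positions y = 2^j, whose
   labels combine to the cyclic rotation of the bits of x, which is g(x) again. Hence the syndrome
   vanishes on S.

   In column c of K_a = W G_a W the nonzero entries sit in the rows r for which r XOR c lies in a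
   set D_p depending only on the parity p of the block of c: the numbers 0 and 1, one of 2^j and
   2^j + 1 for every j with 0 < j < a - m, and both of them for every j with a - m <= j < a. The
   syndrome maps D_p bijectively onto {0, ..., 2^b - 1}, so every coset of S contains exactly one
   row in which column c is nonzero, and each entry of L_a is a single entry of K_a up to sign and
   scale. Orthogonality passes through W and the Hadamard matrix, as both are isometries up to
   scale. *)
theory Submission
  imports Defs
begin

section \<open>Hamming weight parity and bitwise XOR on natural numbers\<close>

declare hw.simps [simp del]

lemma hw_0 [simp]: "hw 0 = 0"
  by (subst hw.simps) simp

lemma hw_rec: "hw n = n mod 2 + hw (n div 2)"
  by (cases "n = 0") (simp, subst hw.simps, simp)

lemma xor_div_power: "xor u v div 2 ^ n = xor (u div 2 ^ n) (v div 2 ^ n)" for u v :: nat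
  by (simp flip: drop_bit_eq_div)

lemma xor_div2: "xor u v div 2 = xor (u div 2) (v div 2)" for u v :: nat
  using xor_div_power [of u v 1] by simp

lemma xor_eq_0_iff: "xor u v = 0 \<longleftrightarrow> u = v" for u v :: nat
  by (metis bit.xor_cancel_right xor.assoc xor.right_neutral xor_self_eq)

lemma xor_left_self [simp]: "xor u (xor u v) = v" for u v :: nat
  by (simp flip: xor.assoc)

lemma xor_less_power: "u < 2 ^ n \<Longrightarrow> v < 2 ^ n \<Longrightarrow> xor u v < 2 ^ n" for u v :: nat
  by (metis take_bit_nat_eq_self_iff take_bit_xor)

text \<open>Common one bits cancel in pairs, so weight parity is \<open>F_2\<close>-linear. This
  later compares the block parities of a row and a column through the XOR of the two indices. The
  induction strips the lowest bit of both arguments.\<close>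

lemma odd_hw_xor: "odd (hw (xor u v)) \<longleftrightarrow> odd (hw u) \<noteq> odd (hw v)"
proof (induction u arbitrary: v rule: less_induct)
  case (less u)
  show ?case
  proof (cases "u = 0")
    case True
    then show ?thesis by simp
  next
    case False
    then have IH: "odd (hw (xor (u div 2) (v div 2))) \<longleftrightarrow> odd (hw (u div 2)) \<noteq> odd (hw (v div 2))"
      using less by simp
    have par: "odd (hw n) \<longleftrightarrow> odd n \<noteq> odd (hw (n div 2))" for n
      by (subst hw_rec) simp
    show ?thesis
      using IH par [of "xor u v"] par [of u] par [of v] by (auto simp: xor_div2 even_xor_iff)
  qed
qed

lemma hw_power2: "hw (2 ^ k) = 1"
  by (induction k) (subst hw_rec, simp)+

lemma not_bit_less_power: "u < 2 ^ n \<Longrightarrow> \<not> bit u n" for u :: nat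
  by (simp add: bit_iff_odd)

text \<open>No carry arises at an unset bit. The integer sums in \<open>hmap\<close> are turned into
  XORs one power of two at a time by this rule.\<close>

lemma add_power_eq_xor: "\<not> bit u n \<Longrightarrow> u + 2 ^ n = xor u (2 ^ n)" for u :: nat
  by (rule disjunctive_add_eq_xor) (rule bit_eqI, auto simp: bit_simps)

section \<open>The parameters \<open>b\<close> and \<open>m\<close>\<close>

lemma bpar_bounds:
  assumes "a \<ge> 1"
  shows "2 ^ (bpar a - 1) \<le> a" "a < 2 ^ bpar a"
proof -
  define k where "k = nat \<lfloor>log 2 (real a)\<rfloor>"
  have "\<lfloor>log 2 (real a)\<rfloor> = int k"
    using assms by (simp add: k_def)
  then have "2 ^ k \<le> a \<and> a < 2 ^ (k + 1)"
    using assms floor_log_nat_eq_powr_iff [of 2 a k] by simp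
  then show "2 ^ (bpar a - 1) \<le> a" "a < 2 ^ bpar a"
    by (simp_all add: bpar_def k_def)
qed

text \<open>As \<open>2 ^ b\<close> is even, \<open>a\<close> and \<open>m\<close> have opposite
  parity. The oddness of \<open>a - m\<close> matters throughout: a pair \<open>2 * k\<close>,
  \<open>2 * k + 1\<close> lies either wholly within or wholly above the bound
  \<open>a - m\<close>.\<close>

lemma mpar_eqs:
  assumes "a \<ge> 1"
  shows "mpar a + a + 1 = 2 ^ bpar a" "(2 :: nat) ^ bpar a = 2 * 2 ^ (bpar a - 1)" "mpar a < a"
    and "odd (a - mpar a)"
proof -
  show 1: "mpar a + a + 1 = 2 ^ bpar a"
    using bpar_bounds [OF assms] by (simp add: mpar_def)
  show 2: "(2 :: nat) ^ bpar a = 2 * 2 ^ (bpar a - 1)"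
    by (simp add: bpar_def)
  show 3: "mpar a < a"
    using 1 2 bpar_bounds [OF assms] by linarith
  have "even (mpar a + a + 1)" unfolding 1 2 by simp
  with 3 show "odd (a - mpar a)" by presburger
qed

section \<open>Orthogonality of G and of transposed Hadamard matrices\<close>

lemma sum_lessThan_add: "(\<Sum>k<m + n. f k) = (\<Sum>k<m. f k) + (\<Sum>k<n. f (k + m))"
  for f :: "nat \<Rightarrow> 'a :: comm_monoid_add"
  by (induction n) (simp_all add: add_ac)

lemma sum_delta_times:
  fixes f :: "nat \<Rightarrow> complex"
  shows "(\<Sum>k<n. (if k = i then u else 0) * f k) = (if i < n then u * f i else 0)"
    and "(\<Sum>k<n. (if i = k then u else 0) * f k) = (if i < n then u * f i else 0)"
    and "(\<Sum>k<n. f k * (if k = i then u else 0)) = (if i < n then f i * u else 0)"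
    and "(\<Sum>k<n. f k * (if i = k then u else 0)) = (if i < n then f i * u else 0)"
proof -
  have *: "(\<Sum>k<n. (if k = i then u else 0) * f k) = (\<Sum>k<n. if k = i then u * f k else 0)"
    by (intro sum.cong) auto
  then show "(\<Sum>k<n. (if k = i then u else 0) * f k) = (if i < n then u * f i else 0)"
    by simp
  then show "(\<Sum>k<n. (if i = k then u else 0) * f k) = (if i < n then u * f i else 0)"
    "(\<Sum>k<n. f k * (if k = i then u else 0)) = (if i < n then f i * u else 0)"
    "(\<Sum>k<n. f k * (if i = k then u else 0)) = (if i < n then f i * u else 0)"
    by (simp_all add: mult.commute eq_commute [of i])
qed

text \<open>Both products are treated together because the lower right block of the recursion is an
  adjoint: each claim for \<open>Suc a\<close> uses both claims for \<open>a\<close>. The mixed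
  blocks cancel since the new variable enters through multiples of the identity.\<close>

lemma Gdes_orthogonal:
  assumes "i < 2 ^ a" "j < 2 ^ a"
  shows "(\<Sum>k<2 ^ a. cnj (Gdes a k i x) * Gdes a k j x) =
           (if i = j then of_real (\<Sum>l\<in>{1..a + 1}. (cmod (x l))\<^sup>2) else 0)"
    and "(\<Sum>k<2 ^ a. Gdes a i k x * cnj (Gdes a j k x)) =
           (if i = j then of_real (\<Sum>l\<in>{1..a + 1}. (cmod (x l))\<^sup>2) else 0)"
  using assms
proof (induction a arbitrary: i j)
  case 0
  { case 1 then show ?case by (simp add: mult.commute flip: complex_norm_square) }
  { case 2 then show ?case by (simp add: mult.commute flip: complex_norm_square) }
next
  case (Suc a)
  define y where "y = x (a + 2)"
  define A where "A = complex_of_real (\<Sum>l\<in>{1..a + 1}. (cmod (x l))\<^sup>2)"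
  have sq: "complex_of_real (\<Sum>l\<in>{1..Suc a + 1}. (cmod (x l))\<^sup>2) = A + y * cnj y"
    by (simp add: A_def y_def flip: complex_norm_square)
  define n :: nat where "n = 2 ^ a"
  \<comment> \<open>The last two forms are the first two with \<open>i\<close> and \<open>j\<close>
    exchanged and the factors commuted; all four are listed so that the simplifier recognises the
    sums in either order.\<close>
  have IH: "(\<Sum>k<n. cnj (Gdes a k i x) * Gdes a k j x) =
           (if i = j then A else 0)"
     "(\<Sum>k<n. Gdes a i k x * cnj (Gdes a j k x)) =
           (if i = j then A else 0)"
     "(\<Sum>k<n. cnj (Gdes a i k x) * Gdes a j k x) =
           (if i = j then A else 0)"
     "(\<Sum>k<n. Gdes a k i x * cnj (Gdes a k j x)) =
           (if i = j then A else 0)"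
    if "i < n" "j < n" for i j
    using Suc.IH [of i j] Suc.IH [of j i] that by (auto simp: n_def A_def mult.commute)
  have split: "(\<Sum>k<2 ^ Suc a. f k) = (\<Sum>k<n. f k) + (\<Sum>k<n. f (k + n))" for f :: "nat \<Rightarrow> complex"
    by (simp add: n_def mult_2 sum_lessThan_add)
  have half: "i < n \<or> (\<exists>i'<n. i = i' + n)" if "i < 2 ^ Suc a" for i
  proof (cases "i < n")
    case False
    then have "i - n < n \<and> i = i - n + n"
      using that by (simp add: n_def)
    then show ?thesis by blast
  qed blast
  have cases: thesis if "i < 2 ^ Suc a" "j < 2 ^ Suc a"
     "i < n \<Longrightarrow> j < n \<Longrightarrow> thesis"
     "\<And>j'. i < n \<Longrightarrow> j' < n \<Longrightarrow> j = j' + n \<Longrightarrow> thesis"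
     "\<And>i'. i' < n \<Longrightarrow> i = i' + n \<Longrightarrow> j < n \<Longrightarrow> thesis"
     "\<And>i' j'. i' < n \<Longrightarrow> i = i' + n \<Longrightarrow> j' < n \<Longrightarrow> j = j' + n \<Longrightarrow> thesis" for thesis i j
    using half [OF that(1)] half [OF that(2)] that(3-) by blast
  have G: "r < n \<Longrightarrow> c < n \<Longrightarrow> Gdes (Suc a) r c x = Gdes a r c x"
      "r < n \<Longrightarrow> Gdes (Suc a) r (c + n) x = (if r = c then - cnj (y) else 0)"
      "c < n \<Longrightarrow> Gdes (Suc a) (r + n) c x = (if r = c then y else 0)"
      "Gdes (Suc a) (r + n) (c + n) x = cnj (Gdes a c r x)" for r c
    by (simp_all add: n_def y_def Let_def)
  { case 1
    show ?case unfolding sq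
      by (rule cases [OF 1]; simp only: split)
        (simp_all add: G sum_delta_times IH if_distrib [of cnj] mult_ac cong: sum.cong_simp if_cong del: Gdes.simps of_real_sum One_nat_def)
  }
  { case 2
    show ?case unfolding sq
      by (rule cases [OF 2]; simp only: split)
        (simp_all add: G sum_delta_times IH if_distrib [of cnj] mult_ac cong: sum.cong_simp if_cong del: Gdes.simps of_real_sum One_nat_def)
  }
qed

text \<open>Passes from orthogonal rows to orthogonal columns without inverting \<open>H\<close>:
  the Gram matrix \<open>P\<close> of the columns is shown to be at Frobenius distance zero from
  \<open>D\<close>, that is from \<open>n\<close> times the identity.\<close>

lemma transpose_orthogonal:
  fixes H :: "nat \<Rightarrow> nat \<Rightarrow> real"
  assumes "\<And>i j. i < n \<Longrightarrow> j < n \<Longrightarrow> (\<Sum>k<n. H i k * H j k) = (if i = j then real n else 0)"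
    and "p < n" "q < n"
  shows "(\<Sum>k<n. H k p * H k q) = (if p = q then real n else 0)"
proof -
  define P where "P p q = (\<Sum>k<n. H k p * H k q)" for p q
  define D where "D p q = (if p = q then real n else 0)" for p q :: nat
  have swap3: "(\<Sum>p<n. \<Sum>k<n. \<Sum>l<n. g p k l) = (\<Sum>k<n. \<Sum>l<n. \<Sum>p<n. g p k l)"
    for g :: "nat \<Rightarrow> nat \<Rightarrow> nat \<Rightarrow> real"
    by (rule trans [OF sum.swap]) (intro sum.cong refl sum.swap)
  \<comment> \<open>Regrouping the fourfold sum turns the squared entries of \<open>P\<close> into
    squared inner products of rows of \<open>H\<close>, which the assumption evaluates.\<close>
  have "(\<Sum>p<n. \<Sum>q<n. (P p q)\<^sup>2) = (\<Sum>p<n. \<Sum>q<n. \<Sum>k<n. \<Sum>l<n. H k p * H k q * (H l p * H l q))"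
    by (simp add: P_def power2_eq_square sum_product)
  also have "\<dots> = (\<Sum>p<n. \<Sum>k<n. \<Sum>l<n. \<Sum>q<n. H k p * H k q * (H l p * H l q))"
    by (intro sum.cong refl swap3)
  also have "\<dots> = (\<Sum>k<n. \<Sum>l<n. \<Sum>p<n. \<Sum>q<n. H k p * H k q * (H l p * H l q))"
    by (rule swap3)
  also have "\<dots> = (\<Sum>k<n. \<Sum>l<n. \<Sum>p<n. \<Sum>q<n. (H k p * H l p) * (H k q * H l q))"
    by (simp add: mult_ac)
  also have "\<dots> = (\<Sum>k<n. \<Sum>l<n. (\<Sum>p<n. H k p * H l p) * (\<Sum>p<n. H k p * H l p))"
    by (simp add: sum_product)
  also have "\<dots> = (\<Sum>k<n. \<Sum>l<n. if k = l then real n * real n else 0)"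
    by (intro sum.cong) (simp_all add: assms(1))
  also have "\<dots> = real n ^ 3"
    by (simp add: power3_eq_cube)
  finally have sq: "(\<Sum>p<n. \<Sum>q<n. (P p q)\<^sup>2) = real n ^ 3" .
  have "(\<Sum>p<n. P p p) = (\<Sum>k<n. \<Sum>p<n. H k p * H k p)"
    unfolding P_def by (rule sum.swap)
  also have "\<dots> = real n ^ 2"
    by (simp add: assms(1) power2_eq_square)
  finally have tr: "(\<Sum>p<n. P p p) = real n ^ 2" .
  \<comment> \<open>The squared Frobenius norm of the difference is \<open>n^3 - 2 n^3 + n^3\<close>.\<close>
  have "(\<Sum>p<n. \<Sum>q<n. (P p q - D p q)\<^sup>2) =
      (\<Sum>p<n. \<Sum>q<n. (P p q)\<^sup>2) + (\<Sum>p<n. \<Sum>q<n. if p = q then real n ^ 2 - 2 * real n * P p p else 0)"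
    unfolding sum.distrib [symmetric]
    by (intro sum.cong) (auto simp: D_def power2_eq_square algebra_simps)
  also have "\<dots> = real n ^ 3 + (real n ^ 3 - 2 * real n * real n ^ 2)"
    by (simp add: sq sum_subtractf tr flip: sum_distrib_left) (simp add: eval_nat_numeral)
  also have "\<dots> = 0" by (simp add: eval_nat_numeral)
  finally have "(\<Sum>p<n. \<Sum>q<n. (P p q - D p q)\<^sup>2) = 0" .
  then have "\<forall>p<n. \<forall>q<n. P p q = D p q"
    by (simp add: sum_nonneg_eq_0_iff sum_nonneg)
  then show ?thesis
    using assms(2,3) by (simp add: P_def D_def)
qed

section \<open>The parity check of S\<close>

text \<open>The \<open>F_2\<close>-linear map that sends the unit vector with bit \<open>j\<close>
  to \<open>w j\<close> for \<open>j < n\<close> and ignores higher bits.\<close>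

fun bit_comb :: "(nat \<Rightarrow> nat) \<Rightarrow> nat \<Rightarrow> nat \<Rightarrow> nat" where
  "bit_comb w 0 v = 0"
| "bit_comb w (Suc n) v = xor (bit_comb w n v) (if bit v n then w n else 0)"

lemma bit_comb_xor: "bit_comb w n (xor u v) = xor (bit_comb w n u) (bit_comb w n v)"
  by (induction n) (auto simp: bit_xor_iff xor.assoc xor.left_commute)

lemma bit_comb_0 [simp]: "bit_comb w n 0 = 0"
  by (induction n) auto

lemma bit_comb_power2: "bit_comb w n (2 ^ k) = (if k < n then w k else 0)"
  by (induction n) (auto simp: bit_simps less_Suc_eq)

text \<open>Column of the parity-check matrix at bit position \<open>y - 1\<close>. The second
  branch undoes the shift that \<open>fprime\<close> applies to the elements leaving
  \<open>Mset a\<close>, as \<open>(mpar a + 1) div 2\<close> is the ceiling of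
  \<open>m / 2\<close>.\<close>

definition label :: "nat \<Rightarrow> nat \<Rightarrow> nat" where
  "label a y = (if even y \<or> y \<le> a - mpar a then y else y - 1 + 2 * ((mpar a + 1) div 2))"

definition syndrome :: "nat \<Rightarrow> nat \<Rightarrow> nat" where
  "syndrome a v = bit_comb (\<lambda>j. label a (Suc j)) a v"

lemma syndrome_xor: "syndrome a (xor u v) = xor (syndrome a u) (syndrome a v)"
  by (simp add: syndrome_def bit_comb_xor)

lemma syndrome_0 [simp]: "syndrome a 0 = 0"
  by (simp add: syndrome_def)

lemma syndrome_power2: "k < a \<Longrightarrow> syndrome a (2 ^ k) = label a (Suc k)"
  by (simp add: syndrome_def bit_comb_power2)

lemma label_1: "a \<ge> 1 \<Longrightarrow> label a (Suc 0) = 1"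
  using mpar_eqs(3) [of a] by (simp add: label_def)

lemma syndrome_1: "a \<ge> 1 \<Longrightarrow> syndrome a (Suc 0) = 1"
  using syndrome_power2 [of 0 a] label_1 [of a] by simp

text \<open>An odd rotated value \<open>z\<close> comes from \<open>x >= P\<close> and is then at
  most \<open>2 * a + 1 - 2 * P = a - m\<close>, so a \<open>z\<close> inside \<open>Mset a\<close>
  is its own label. A \<open>z\<close> outside exceeds \<open>a\<close> and is shifted by
  \<open>fprime\<close> to an odd number above \<open>a - m\<close>, where \<open>label\<close>
  shifts back. That \<open>fmap a x\<close> is no power of two keeps its bit apart from the other
  bits of \<open>hmap a x\<close>.\<close>

lemma fmap_props:
  assumes a: "a \<ge> 1" and x: "x \<in> Mset a"
  shows "1 \<le> fmap a x" "fmap a x \<le> a" "\<not> (\<exists>j. fmap a x = 2 ^ j)"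
    "label a (fmap a x) = gmap a x"
proof -
  define P :: nat where "P = 2 ^ (bpar a - 1)"
  define m where "m = mpar a"
  define z where "z = gmap a x"
  have P: "P \<le> a" "m + a + 1 = 2 * P" "m < a" "2 ^ bpar a = 2 * P"
    using bpar_bounds [OF a] mpar_eqs [OF a] by (simp_all add: P_def m_def)
  have xM: "0 < x" "x \<le> a" "\<And>j. x \<noteq> 2 ^ j"
    using x by (auto simp: Mset_def)
  have odd_not_power: "y \<noteq> 2 ^ j" if "odd y" "y > 1" for y j :: nat
    using that by (cases j) auto
  have digit: "digit x (bpar a - 1) = (if x < P then 0 else 1)"
  proof (cases "x < P")
    case False
    then have "x div P = 1"
      using xM P by (intro div_nat_eqI) auto
    then show ?thesis using False by (simp add: digit_def P_def)
  qed (simp add: digit_def P_def)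
  have z: "z = (if x < P then 2 * x else 2 * x + 1 - 2 * P)"
    by (auto simp: z_def gmap_def digit [simplified] P)
  have "1 \<le> fmap a x \<and> fmap a x \<le> a \<and> \<not> (\<exists>j. fmap a x = 2 ^ j) \<and> label a (fmap a x) = z"
  proof (cases "z \<in> Mset a")
    case True
    then have "fmap a x = z"
      using x by (simp add: fmap_def fprime_def z_def)
    moreover have "even z \<or> z \<le> a - m"
      using z xM P by auto
    ultimately show ?thesis
      using True by (auto simp: Mset_def label_def m_def)
  next
    case False
    have "x < P"
    proof (rule ccontr)
      assume "\<not> x < P"
      moreover have "x \<noteq> P" using xM(3) by (simp add: P_def)
      ultimately have "odd z" "z > 1" "z \<le> a" using z xM P by auto
      then show False using False odd_not_power [of z] by (auto simp: Mset_def)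
    qed
    then have z2: "z = 2 * x" using z by simp
    have "z \<noteq> 2 ^ j" for j
      using z2 xM(3) [of "j - 1"] by (cases j) auto
    then have "z > a" using False z2 xM by (auto simp: Mset_def)
    define y where "y = z + 1 - 2 * ((m + 1) div 2)"
    have y: "fmap a x = y"
      using False by (simp add: fmap_def fprime_def z_def y_def m_def)
    define k where "k = (m + 1) div 2"
    have k: "2 * k = m \<or> 2 * k = m + 1" unfolding k_def by presburger
    then have "k \<le> x" using \<open>z > a\<close> z2 P by linarith
    then have y2: "y = 2 * (x - k) + 1" unfolding y_def z2 k_def by simp
    then have "odd y" by simp
    have 1: "a - m < y" "y \<le> a" "y - 1 + 2 * ((m + 1) div 2) = z"
      using k \<open>k \<le> x\<close> \<open>z > a\<close> z2 \<open>x < P\<close> P unfolding y2 k_def [symmetric] by linarith+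
    then have "y > 1" using P by linarith
    then show ?thesis
      using 1 \<open>odd y\<close> odd_not_power [of y] by (auto simp: y label_def m_def)
  qed
  then show "1 \<le> fmap a x" "fmap a x \<le> a" "\<not> (\<exists>j. fmap a x = 2 ^ j)"
    "label a (fmap a x) = gmap a x"
    by (simp_all add: z_def)
qed

text \<open>Bit \<open>2 ^ (j + 1) - 1\<close> has the even label \<open>2 ^ (j + 1)\<close>, so the
  digits of \<open>x\<close> reappear one place higher. The set bits of the partial sum are tracked
  as well, to rule out carries in the next step; \<open>k < bpar a\<close> keeps all positions below
  \<open>a\<close>.\<close>

lemma digit_sum:
  fixes x :: nat
  assumes "a \<ge> 1" "k < bpar a"
  defines "T \<equiv> \<Sum>j<k. digit x j * 2 ^ (2 ^ (j + 1) - 1)"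
  shows "T < 2 ^ a" "bit T n \<Longrightarrow> \<exists>j<k. n + 1 = 2 ^ (j + 1)" "syndrome a T = 2 * (x mod 2 ^ k)"
proof -
  have "k < bpar a \<Longrightarrow> T < 2 ^ a \<and> (\<forall>n. bit T n \<longrightarrow> (\<exists>j<k. n + 1 = 2 ^ (j + 1))) \<and> syndrome a T = 2 * (x mod 2 ^ k)"
    unfolding T_def
  proof (induction k)
    case 0
    then show ?case by simp
  next
    case (Suc k)
    define T where "T = (\<Sum>j<k. digit x j * 2 ^ (2 ^ (j + 1) - 1))"
    have IH: "T < 2 ^ a" "\<And>n. bit T n \<Longrightarrow> \<exists>j<k. n + 1 = 2 ^ (j + 1)" "syndrome a T = 2 * (x mod 2 ^ k)"
      using Suc by (auto simp: T_def)
    have sum: "(\<Sum>j<Suc k. digit x j * 2 ^ (2 ^ (j + 1) - 1)) = T + digit x k * 2 ^ (2 ^ (k + 1) - 1)"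
      by (simp add: T_def)
    have md: "x mod 2 ^ Suc k = x mod 2 ^ k + digit x k * 2 ^ k"
      using mod_mult2_eq [of x "2 ^ k" 2] by (simp add: digit_def mult.commute)
    show ?case
    proof (cases "digit x k = 0")
      case True
      then show ?thesis unfolding sum md using IH by (auto simp del: power_Suc intro: less_SucI)
    next
      case False
      define N :: nat where "N = 2 ^ (k + 1) - 1"
      have "(2::nat) ^ (k + 1) \<le> 2 ^ (bpar a - 1)"
        using Suc.prems by (intro power_increasing) auto
      then have pk: "2 ^ (k + 1) \<le> a"
        using bpar_bounds [OF assms(1)] by linarith
      have N: "N + 1 = 2 ^ (k + 1)" "N < a" using pk one_le_power [of "2 :: nat" "k + 1"] unfolding N_def by linarith+
      have d: "digit x k = 1" using False by (auto simp: digit_def)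
      have "\<not> bit T N"
      proof
        assume "bit T N"
        from IH(2) [OF this] N show False by auto
      qed
      then have xr: "T + 2 ^ N = xor T (2 ^ N)" by (rule add_power_eq_xor)
      have ev: "even (Suc N)" using N by simp
      have "syndrome a (xor T (2 ^ N)) = xor (2 * (x mod 2 ^ k)) (2 ^ Suc k)"
        using IH(3) N ev by (simp add: syndrome_xor syndrome_power2 label_def)
      also have "\<dots> = 2 * (x mod 2 ^ k) + 2 ^ Suc k"
      proof -
        have "2 * (x mod 2 ^ k) < 2 ^ Suc k" by simp
        then show ?thesis
          by (intro add_power_eq_xor [symmetric]) (rule not_bit_less_power)
      qed
      finally have "syndrome a (T + 2 ^ N) = 2 * (x mod 2 ^ Suc k)"
        unfolding md d xr by (simp add: algebra_simps)
      moreover have "T + 2 ^ N < 2 ^ a"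
        unfolding xr using IH(1) N by (intro xor_less_power) auto
      moreover have "\<exists>j<Suc k. n + 1 = 2 ^ (j + 1)" if "bit (T + 2 ^ N) n" for n
        using that IH(2) [of n] N unfolding xr by (auto simp: bit_simps simp del: power_Suc intro: less_SucI)
      ultimately show ?thesis unfolding sum d N_def [symmetric] by simp
    qed
  qed
  with assms(2) show "T < 2 ^ a" "bit T n \<Longrightarrow> \<exists>j<k. n + 1 = 2 ^ (j + 1)" "syndrome a T = 2 * (x mod 2 ^ k)"
    by auto
qed

text \<open>The three parts of \<open>hmap\<close> occupy different bits, so their sum is an XOR.
  The digits contribute the cyclic left rotation of \<open>x\<close>, the power with exponent
  \<open>fmap a x - 1\<close> contributes \<open>label a (fmap a x)\<close>, and both are
  \<open>gmap a x\<close>.\<close>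

lemma hmap_syndrome:
  assumes a: "a \<ge> 1" and x: "x \<in> Mset a"
  shows "hmap a x < 2 ^ a" "syndrome a (hmap a x) = 0"
proof -
  define P :: nat where "P = 2 ^ (bpar a - 1)"
  define T where "T = (\<Sum>j<bpar a - 1. digit x j * 2 ^ (2 ^ (j + 1) - 1))"
  define d where "d = digit x (bpar a - 1)"
  define N where "N = fmap a x - 1"
  have "bpar a - 1 < bpar a" by (simp add: bpar_def)
  note T = digit_sum [OF a this, of x, folded T_def]
  have N: "N < a" "\<And>j. N + 1 \<noteq> 2 ^ j" "label a (Suc N) = gmap a x"
    using fmap_props [OF a x] by (auto simp: N_def)
  have d01: "d = 0 \<or> d = 1" by (auto simp: d_def digit_def)
  have "\<not> bit T 0"
    using T(2) [of 0] by auto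
  then have e0: "T + 2 ^ 0 = xor T (2 ^ 0)" by (rule add_power_eq_xor)
  have 1: "T + d = xor T d" using d01 e0 by auto
  have "N \<noteq> 0" using N(2) [of 0] by auto
  have "\<not> bit T N"
    using T(2) [of N] N(2) by blast
  then have "\<not> bit (T + d) N"
    using d01 \<open>N \<noteq> 0\<close> unfolding 1 by (auto simp: bit_simps)
  then have "T + d + 2 ^ N = xor (T + d) (2 ^ N)" by (rule add_power_eq_xor)
  then have h: "hmap a x = xor (xor T d) (2 ^ N)"
    using 1 by (simp add: hmap_def T_def N_def d_def add_ac)
  have "(1 :: nat) < 2 ^ a" using a by (intro one_less_power) auto
  then have "d < 2 ^ a" using d01 by auto
  then show "hmap a x < 2 ^ a"
    unfolding h using T(1) N by (intro xor_less_power) auto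
  have "xor (2 * (x mod P)) d = gmap a x"
  proof -
    have "xor (2 * u) d = 2 * u + d" for u
      using d01 add_power_eq_xor [of "2 * u" 0] by (auto simp: bit_0)
    moreover have "x < 2 * P"
      using x bpar_bounds [OF a] mpar_eqs [OF a] by (simp add: Mset_def P_def)
    then have "x div P < 2"
      by (simp add: less_mult_imp_div_less)
    then have "d = x div P"
      by (simp add: d_def digit_def P_def)
    then have "x = d * P + x mod P"
      by simp
    moreover have "gmap a x = (if d = 0 then 2 * x else 2 * x + 1 - 2 * P)"
      unfolding gmap_def d_def P_def mpar_eqs(2) [OF a] ..
    ultimately show ?thesis
      using d01 by auto
  qed
  moreover have "syndrome a d = d" using d01 syndrome_1 [OF a] by auto
  ultimately show "syndrome a (hmap a x) = 0"
    unfolding h syndrome_xor T(3) by (simp add: P_def syndrome_power2 N)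
qed

lemma Sspace_props:
  assumes a: "a \<ge> 1" and s: "s \<in> Sspace a"
  shows "s < 2 ^ a" "syndrome a s = 0"
proof -
  from s have "s < 2 ^ a \<and> syndrome a s = 0"
    unfolding Sspace_def
    by induction (auto simp: hmap_syndrome [OF a] syndrome_xor intro: xor_less_power)
  then show "s < 2 ^ a" "syndrome a s = 0" by auto
qed

lemma xor_span_closed: "u \<in> xor_span A \<Longrightarrow> v \<in> xor_span A \<Longrightarrow> xor u v \<in> xor_span A"
  by (induction rule: xor_span.induct) (auto simp: xor.assoc intro: xor_span.step)

lemma xor_power2_add:
  fixes u v :: nat
  assumes "u < 2 ^ n" "v < 2 ^ n"
  shows "xor u (v + 2 ^ n) = xor u v + 2 ^ n"
    and "xor (v + 2 ^ n) u = xor u v + 2 ^ n"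
    and "xor (u + 2 ^ n) (v + 2 ^ n) = xor u v"
  using add_power_eq_xor [OF not_bit_less_power [OF assms(1)]]
    add_power_eq_xor [OF not_bit_less_power [OF assms(2)]]
    add_power_eq_xor [OF not_bit_less_power [OF xor_less_power [OF assms]]]
  by (simp_all add: xor.assoc xor.left_commute xor.commute [of _ "2 ^ n"] xor.commute [of v u])

section \<open>Index pairs, the support of a column of \<open>K\<close> and its syndromes\<close>

lemma xor_1_nat: "xor u 1 = (if even u then u + 1 else u - 1)" for u :: nat
proof (cases "even u")
  case True
  then show ?thesis using add_power_eq_xor [of u 0] by (simp add: bit_0)
next
  case False
  then have "u = xor (u - 1) 1"
    using add_power_eq_xor [of "u - 1" 0] by (simp add: bit_0)
  then have "xor u 1 = u - 1"
    by (metis xor.assoc xor.right_neutral xor_self_eq)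
  then show ?thesis using False by simp
qed

lemma div2_eq_iff: "s div 2 = r div 2 \<longleftrightarrow> s = r \<or> s = xor r 1" for r s :: nat
  unfolding xor_1_nat by presburger

text \<open>Here \<open>d\<close> stands for row index XOR column index and \<open>p\<close> for the
  block parity of the column. The exponent is shifted by the halving: \<open>d\<close> has the
  single bit \<open>j + 1\<close> besides bit 0, and for \<open>j + 1 < a - m\<close> bit 0 must be
  set exactly when \<open>p\<close> holds.\<close>

definition in_support :: "nat \<Rightarrow> bool \<Rightarrow> nat \<Rightarrow> bool" where
  "in_support a p d \<longleftrightarrow> d div 2 = 0 \<or>
     (\<exists>j<a - 1. d div 2 = 2 ^ j \<and> (j + 1 < a - mpar a \<longrightarrow> (odd d \<longleftrightarrow> p)))"

text \<open>Passes to the 1-based position \<open>y = j + 2\<close> used by \<open>label\<close> and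
  to the lowest bit \<open>e\<close>, since an element given in this form has the syndrome
  \<open>xor (label a y) e\<close>.\<close>

lemma in_support_iff:
  "in_support a p d \<longleftrightarrow> d < 2 \<or>
     (\<exists>y\<in>{2..a}. \<exists>e\<in>{0, 1}. d = xor (2 ^ (y - 1)) e \<and> (y \<le> a - mpar a \<longrightarrow> e = of_bool p))"
proof -
  have *: "d div 2 = 2 ^ j \<longleftrightarrow> d = xor (2 ^ Suc j) (d mod 2)" for j
  proof -
    have "xor (2 ^ Suc j) (d mod 2) = 2 ^ Suc j + d mod 2"
      using xor_1_nat [of "2 ^ Suc j"] by (cases "even d") (auto simp: odd_iff_mod_2_eq_one)
    moreover have "d = 2 * (d div 2) + d mod 2" by simp
    ultimately show ?thesis by (simp, linarith)
  qed
  show ?thesis (is "?L \<longleftrightarrow> ?R")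
  proof
    assume ?L
    then consider "d < 2" | j where "j < a - 1" "d div 2 = 2 ^ j" "j + 1 < a - mpar a \<longrightarrow> (odd d \<longleftrightarrow> p)"
      by (auto simp: in_support_def)
    then show ?R
    proof cases
      case 2
      then have "d = xor (2 ^ (j + 2 - 1)) (d mod 2)" using * by simp
      moreover have "d mod 2 \<in> {0, 1}" by auto
      moreover have "j + 2 \<in> {2..a}" using 2 by auto
      moreover have "j + 2 \<le> a - mpar a \<longrightarrow> d mod 2 = of_bool p"
        using 2(3) by (auto simp: odd_iff_mod_2_eq_one)
      ultimately show ?thesis
        by (intro disjI2 bexI [of _ "j + 2"] bexI [of _ "d mod 2"] conjI)
    qed simp
  next
    assume ?R
    then consider "d < 2" | y e where "2 \<le> y" "y \<le> a" "e = 0 \<or> e = 1" "d = xor (2 ^ (y - 1)) e"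
       "y \<le> a - mpar a \<longrightarrow> e = of_bool p"
      by (metis atLeastAtMost_iff insert_iff empty_iff)
    then show ?L
    proof cases
      case 2
      have "even (2 ^ (y - 1) :: nat)" using 2(1) by simp
      then have "d = 2 ^ (y - 1) + e"
        using 2(3,4) xor_1_nat [of "2 ^ (y - 1)"] by (elim disjE) simp_all
      moreover obtain w :: nat where "2 ^ (y - 1) = 2 * w"
        using \<open>even (2 ^ (y - 1))\<close> by (elim evenE)
      ultimately have "d = 2 * w + e" by simp
      then have "d mod 2 = e" using 2(3) by (elim disjE) simp_all
      moreover have "Suc (y - 2) = y - 1" using 2(1) by simp
      ultimately have "d div 2 = 2 ^ (y - 2)" using * [of "y - 2"] 2(4) by simp
      moreover have "y - 2 < a - 1" using 2(1,2) by linarith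
      moreover have "y - 2 + 1 < a - mpar a \<longrightarrow> (odd d \<longleftrightarrow> p)"
      proof
        assume "y - 2 + 1 < a - mpar a"
        then have "e = of_bool p" using 2(1,5) by linarith
        then show "odd d \<longleftrightarrow> p" using \<open>d mod 2 = e\<close> by (auto simp: odd_iff_mod_2_eq_one)
      qed
      ultimately show ?thesis unfolding in_support_def by blast
    qed (simp add: in_support_def)
  qed
qed

text \<open>Since \<open>a - m\<close> is odd, an odd \<open>y\<close> above it is at least
  \<open>a - m + 2\<close>, and adding \<open>2 * k - 1 >= m - 1\<close>, with \<open>k\<close> the
  ceiling of \<open>m / 2\<close>, lifts it above \<open>a\<close>. So the large labels are even,
  and even and odd positions cannot share one.\<close>

lemma label_props:
  assumes a: "a \<ge> 1" and y: "2 \<le> y" "y \<le> a"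
  shows "y \<le> a - mpar a \<Longrightarrow> label a y = y"
    and "a - mpar a < y \<Longrightarrow> even (label a y)"
    and "a - mpar a < y \<Longrightarrow> a - mpar a < label a y"
    and "a - mpar a < y \<Longrightarrow> odd y \<Longrightarrow> a < label a y"
    and "2 \<le> label a y"
proof -
  define k where "k = (mpar a + 1) div 2"
  have k: "mpar a \<le> 2 * k" unfolding k_def by presburger
  obtain t where t: "a - mpar a = 2 * t + 1"
    using mpar_eqs(4) [OF a] by (elim oddE)
  have "label a y = y - 1 + 2 * k \<and> a < y - 1 + 2 * k" if "a - mpar a < y" "odd y"
  proof -
    from \<open>odd y\<close> obtain s where s: "y = 2 * s + 1" by (elim oddE)
    then have "s \<ge> t + 1" using that t by linarith
    then show ?thesis using that s t k mpar_eqs(3) [OF a] by (simp add: label_def k_def)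
  qed
  then show "y \<le> a - mpar a \<Longrightarrow> label a y = y"
    and "a - mpar a < y \<Longrightarrow> even (label a y)"
    and "a - mpar a < y \<Longrightarrow> a - mpar a < label a y"
    and "a - mpar a < y \<Longrightarrow> odd y \<Longrightarrow> a < label a y"
    and "2 \<le> label a y"
    using y by (auto simp: label_def)
qed

lemma syndrome_xor_power2:
  assumes a: "a \<ge> 1" and y: "2 \<le> y" "y \<le> a" and e: "e \<in> {0, 1}"
  shows "syndrome a (xor (2 ^ (y - 1)) e) = xor (label a y) e"
  using assms syndrome_1 [OF a] by (auto simp: syndrome_xor syndrome_power2)

text \<open>Up to the bound \<open>a - m\<close> the lowest bit is prescribed by \<open>p\<close>
  and the label is \<open>y\<close> itself; above it the label is even, so the lowest bit of the
  syndrome reveals \<open>e\<close> and the rest reveals the label. The two ranges are already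
  separated after halving.\<close>

lemma syndrome_inj_on_support:
  assumes a: "a \<ge> 1" and d: "in_support a p d" "in_support a p d'"
    and eq: "syndrome a d = syndrome a d'"
  shows "d = d'"
proof -
  \<comment> \<open>With \<open>a - m = 2 * t + 1\<close>, half of a small label is at most
    \<open>t\<close>, while half of a large label, which is even, is at least
    \<open>t + 1\<close>.\<close>
  have main: False if "y \<le> a - mpar a" "\<not> y' \<le> a - mpar a" "2 \<le> y" "y' \<le> a" "e \<in> {0,1}" "e' \<in> {0,1}"
    "xor (label a y) e = xor (label a y') e'" for y y' e e'
  proof -
    have "label a y div 2 = label a y' div 2"
      using arg_cong [OF that(7), of "\<lambda>u. u div 2"] that(5,6) by (auto simp: xor_div2)
    moreover have "label a y = y" "even (label a y')" "label a y' > a - mpar a"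
      using label_props [OF a, of y] label_props [OF a, of y'] that mpar_eqs(3) [OF a] by auto
    moreover obtain t where "a - mpar a = 2 * t + 1"
      using mpar_eqs(4) [OF a] by (elim oddE)
    ultimately have "y div 2 \<le> t" "label a y' div 2 \<ge> t + 1"
      using that(1) by linarith+
    with \<open>label a y div 2 = _\<close> \<open>label a y = y\<close> show False by simp
  qed
  have small: "syndrome a d = d" if "d < 2" for d
    using that syndrome_1 [OF a] by (cases d) auto
  have large: "syndrome a d \<ge> 2" if supp: "in_support a p d" "\<not> d < 2" for d
  proof -
    obtain y e where that: "d = xor (2 ^ (y - 1)) e" "y \<in> {2..a}" "e \<in> {0,1}"
      using supp unfolding in_support_iff by blast
    have "syndrome a d div 2 = label a y div 2"
      using that syndrome_xor_power2 [OF a, of y e] by (auto simp: xor_div2)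
    moreover have "2 \<le> label a y" using label_props(5) [OF a, of y] that by auto
    ultimately have "1 \<le> syndrome a d div 2" by simp
    then show ?thesis by simp
  qed
  consider "d < 2" "d' < 2" | "d < 2" "\<not> d' < 2" | "\<not> d < 2" "d' < 2" | "\<not> d < 2" "\<not> d' < 2" by blast
  then show ?thesis
  proof cases
    case 1 then show ?thesis using small eq by auto
  next
    case 2 then show ?thesis using small [of d] large [of d'] d(2) eq by linarith
  next
    case 3 then show ?thesis using small [of d'] large [of d] d(1) eq by linarith
  next
    case 4
    obtain y e where y: "y \<in> {2..a}" "e \<in> {0,1}" "d = xor (2 ^ (y - 1)) e" "y \<le> a - mpar a \<longrightarrow> e = of_bool p"
      using 4 d(1) unfolding in_support_iff by blast
    obtain y' e' where y': "y' \<in> {2..a}" "e' \<in> {0,1}" "d' = xor (2 ^ (y' - 1)) e'" "y' \<le> a - mpar a \<longrightarrow> e' = of_bool p"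
      using 4 d(2) unfolding in_support_iff by blast
    have yr: "2 \<le> y" "y \<le> a" "2 \<le> y'" "y' \<le> a" using y(1) y'(1) by simp_all
    have s: "xor (label a y) e = xor (label a y') e'"
      using eq syndrome_xor_power2 [OF a yr(1,2) y(2)] syndrome_xor_power2 [OF a yr(3,4) y'(2)]
      unfolding y(3) y'(3) by simp
    have cancel: "u = v" if "xor u e = xor v e" for u v e :: nat
      using that by (metis xor.assoc xor.right_neutral xor_self_eq)
    consider "y \<le> a - mpar a" "y' \<le> a - mpar a" | "y > a - mpar a" "y' > a - mpar a"
      using main [OF _ _ yr(1,4) y(2) y'(2) s] main [OF _ _ yr(3,2) y'(2) y(2) s [symmetric]]
      by (meson not_le)
    then have "y = y' \<and> e = e'"
    proof cases
      case 1
      then have e: "e = of_bool p" "e' = of_bool p" using y(4) y'(4) by blast+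
      have "label a y = label a y'" by (rule cancel [OF s [unfolded e]])
      then show ?thesis
        unfolding e label_props(1) [OF a yr(1,2) 1(1)] label_props(1) [OF a yr(3,4) 1(2)] by simp
    next
      case 2
      then have ev: "even (label a y)" "even (label a y')"
        using label_props(2) [OF a] yr by blast+
      then have e: "e = e'"
        using arg_cong [OF s, of even] y(2) y'(2) by (cases "e = 0"; cases "e' = 0") (simp_all add: even_xor_iff)
      have "label a y = label a y'"
        by (rule cancel [OF s [unfolded e]])
      \<comment> \<open>Equal labels force equal parities: an even \<open>y\<close> is its own label
        and at most \<open>a\<close>, an odd one has a label above \<open>a\<close>.\<close>
      then have "y = y'"
        using label_props(4) [OF a yr(1,2) 2(1)] label_props(4) [OF a yr(3,4) 2(2)] yr 2
        by (cases "even y"; cases "even y'") (auto simp: label_def)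
      with e show ?thesis by simp
    qed
    then show ?thesis using y(3) y'(3) by simp
  qed
qed

lemma syndrome_surj_on_support:
  assumes a: "a \<ge> 1" and z: "z < 2 ^ bpar a"
  obtains d where "d < 2 ^ a" "in_support a p d" "syndrome a d = z"
proof -
  have two: "(2 :: nat) \<le> 2 ^ a" using a by (cases a) auto
  have "\<exists>y\<in>{2..a}. \<exists>e\<in>{0,1}. xor (label a y) e = z \<and> (y \<le> a - mpar a \<longrightarrow> e = of_bool p)" if "z \<ge> 2"
  proof (cases "z \<le> a - mpar a")
    case True
    \<comment> \<open>The lowest bit \<open>e\<close> is forced to be \<open>p\<close>, so
      \<open>y\<close> is \<open>z\<close> with this bit removed by XOR. As \<open>a - m\<close> is
      odd, \<open>y\<close> stays in the range from 2 to \<open>a - m\<close>.\<close>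
    define y where "y = xor z (of_bool p)"
    have y: "2 \<le> y" "y \<le> a - mpar a"
    proof -
      have "z \<noteq> a - mpar a" if "even z" using that mpar_eqs(4) [OF a] by metis
      moreover have "z \<noteq> 2" if "odd z" using that by auto
      ultimately show "2 \<le> y" "y \<le> a - mpar a"
        using \<open>z \<ge> 2\<close> True xor_1_nat [of z] unfolding y_def by (cases p; cases "even z"; simp)+
    qed
    then have "xor (label a y) (of_bool p) = z"
      using label_props(1) [OF a, of y] by (simp add: y_def xor.assoc)
    then show ?thesis using y by (intro bexI [of _ y] bexI [of _ "of_bool p"]) auto
  next
    case False
    define u e where "u = 2 * (z div 2)" and "e = z mod 2"
    define k where "k = (mpar a + 1) div 2"
    have k: "2 * k = mpar a \<or> 2 * k = mpar a + 1" unfolding k_def by presburger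
    obtain t where t: "a - mpar a = 2 * t + 1"
      using mpar_eqs(4) [OF a] by (elim oddE)
    have "t < z div 2" using False t by linarith
    have ze: "z = u + e" by (simp add: u_def e_def)
    have e: "e = 0 \<or> e = 1" by (auto simp: e_def)
    have "even u" by (simp add: u_def)
    then have "xor u e = u + e" using e xor_1_nat [of u] by (elim disjE) simp_all
    then have ue: "even u" "e \<in> {0,1}" "xor u e = z"
      using e ze \<open>even u\<close> by auto
    \<comment> \<open>Inverts \<open>label\<close> on even values: up to \<open>a\<close> they label
      themselves, beyond \<open>a\<close> they come from the odd position obtained by undoing the
      shift.\<close>
    define y where "y = (if u \<le> a then u else u + 1 - 2 * ((mpar a + 1) div 2))"
    have y: "a - mpar a < y \<and> y \<le> a \<and> label a y = u"
    proof (cases "u \<le> a")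
      case True
      then show ?thesis
        using \<open>t < z div 2\<close> t by (auto simp: y_def label_def u_def)
    next
      case False
      have "k \<le> z div 2" using k False mpar_eqs(3) [OF a] unfolding u_def by linarith
      then have y2: "y = 2 * (z div 2 - k) + 1" using False by (simp add: y_def u_def k_def)
      then have "odd y" by simp
      have "z div 2 < 2 ^ (bpar a - 1)" using z mpar_eqs(2) [OF a] by linarith
      then have 1: "a - mpar a < y" "y \<le> a" "y - 1 + 2 * k = u"
        using k False \<open>k \<le> z div 2\<close> mpar_eqs(1-3) [OF a] unfolding y2 u_def by linarith+
      then show ?thesis using \<open>odd y\<close> by (simp add: label_def k_def)
    qed
    moreover have "y \<ge> 2" using y t False \<open>z \<ge> 2\<close> mpar_eqs(3) [OF a] by linarith
    ultimately show ?thesis using ue by (intro bexI [of _ y] bexI [of _ e]) auto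
  qed
  then have "z < 2 \<or> (\<exists>y\<in>{2..a}. \<exists>e\<in>{0,1}. xor (label a y) e = z \<and> (y \<le> a - mpar a \<longrightarrow> e = of_bool p))"
    by linarith
  then consider "z < 2" | y e where "y \<in> {2..a}" "e \<in> {0,1}" "xor (label a y) e = z" "y \<le> a - mpar a \<longrightarrow> e = of_bool p"
    by blast
  then show thesis
  proof cases
    case 1
    then show ?thesis using that [of z] two syndrome_1 [OF a] by (cases z) (auto simp: in_support_def)
  next
    case 2
    have "xor (2 ^ (y - 1)) e < 2 ^ a"
    proof (rule xor_less_power)
      show "2 ^ (y - 1) < (2 :: nat) ^ a"
        using 2(1) by (intro power_strict_increasing) auto
      show "e < 2 ^ a" using 2(2) two by auto
    qed
    moreover have "in_support a p (xor (2 ^ (y - 1)) e)"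
      unfolding in_support_iff using 2 by blast
    moreover have "syndrome a (xor (2 ^ (y - 1)) e) = z"
      using 2(1-3) syndrome_xor_power2 [OF a, of y e] by simp
    ultimately show ?thesis by (rule that)
  qed
qed

section \<open>Two-by-two blocks of G and K\<close>

definition var_entry :: "nat \<Rightarrow> ((nat \<Rightarrow> complex) \<Rightarrow> complex) \<Rightarrow> bool" where
  "var_entry nv y \<longleftrightarrow> (\<exists>i\<in>{1..nv}. \<exists>s cj. (s = 1 \<or> s = -1) \<and>
     (\<forall>x. y x = complex_of_real s * (if cj then cnj (x i) else x i)))"

lemma var_entry_mono: "var_entry n y \<Longrightarrow> n \<le> n' \<Longrightarrow> var_entry n' y"
  unfolding var_entry_def by (meson atLeastAtMost_iff order_trans)

lemma var_entry_cnj: "var_entry n y \<Longrightarrow> var_entry n (\<lambda>x. cnj (y x))"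
  unfolding var_entry_def
proof (elim bexE exE conjE)
  fix i s cj
  assume "i \<in> {1..n}" "s = 1 \<or> s = -1" "\<forall>x. y x = complex_of_real s * (if cj then cnj (x i) else x i)"
  then show "\<exists>i\<in>{1..n}. \<exists>s cj. (s = 1 \<or> s = -1) \<and>
     (\<forall>x. cnj (y x) = complex_of_real s * (if cj then cnj (x i) else x i))"
    by (intro bexI [of _ i] exI [of _ s] exI [of _ "\<not> cj"]) auto
qed

lemma Gdes_blocks:
  "r < 2 ^ a \<Longrightarrow> c < 2 ^ a \<Longrightarrow> Gdes (Suc a) r c x = Gdes a r c x"
  "r < 2 ^ a \<Longrightarrow> Gdes (Suc a) r (c + 2 ^ a) x = (if r = c then - cnj (x (a + 2)) else 0)"
  "c < 2 ^ a \<Longrightarrow> Gdes (Suc a) (r + 2 ^ a) c x = (if r = c then x (a + 2) else 0)"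
  "Gdes (Suc a) (r + 2 ^ a) (c + 2 ^ a) x = cnj (Gdes a c r x)"
  by (simp_all add: Let_def)

declare Gdes.simps [simp del]

lemma xor_1_neq: "xor r 1 \<noteq> r" for r :: nat
  using xor_eq_0_iff [of "xor r 1" r] by (simp add: xor.left_commute [of r] xor.commute [of _ r])

lemma less_Suc_power_cases:
  fixes q :: nat
  assumes "q < 2 ^ Suc n"
  obtains "q < 2 ^ n" | t where "t < 2 ^ n" "q = t + 2 ^ n"
proof (cases "q < 2 ^ n")
  case False
  then show ?thesis using assms that(2) [of "q - 2 ^ n"] by simp
qed (rule that)

text \<open>The recursion fills the diagonal with copies and adjoints of smaller matrices, down to
  \<open>G_1\<close>; two successive adjoints cancel.\<close>

lemma Gdes_diag_block:
  assumes "q < 2 ^ n"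
  shows "(\<forall>u<2. \<forall>v<2. \<forall>x. Gdes (Suc n) (2 * q + u) (2 * q + v) x = Gdes 1 u v x) \<or>
    (\<forall>u<2. \<forall>v<2. \<forall>x. Gdes (Suc n) (2 * q + u) (2 * q + v) x = cnj (Gdes 1 v u x))"
  using assms
proof (induction n arbitrary: q)
  case 0
  then show ?case by simp
next
  case (Suc n)
  have lt: "2 * t + u < 2 ^ Suc n" if "t < 2 ^ n" "u < 2" for t u :: nat
    using that by simp
  from Suc.prems show ?case
  proof (cases rule: less_Suc_power_cases)
    case 1
    have "Gdes (Suc (Suc n)) (2 * q + u) (2 * q + v) x = Gdes (Suc n) (2 * q + u) (2 * q + v) x"
      if "u < 2" "v < 2" for u v x
      by (intro Gdes_blocks lt 1 that)
    then show ?thesis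
      using Suc.IH [OF 1] by auto
  next
    case (2 t)
    have "2 * q + u = (2 * t + u) + 2 ^ Suc n" for u using 2 by simp
    then have "Gdes (Suc (Suc n)) (2 * q + u) (2 * q + v) x = cnj (Gdes (Suc n) (2 * t + v) (2 * t + u) x)" for u v x
      by (simp only: Gdes_blocks)
    then show ?thesis
      using Suc.IH [OF 2(1)] by auto
  qed
qed

text \<open>Each new variable enters through a multiple of an identity matrix of even size, so off
  the diagonal every 2 by 2 block is a scalar multiple \<open>y\<close> of the identity. It is
  nonzero exactly when the block indices differ in one bit, namely that of the recursion level
  introducing the variable.\<close>

lemma Gdes_off_diag_block:
  assumes "q < 2 ^ n" "q' < 2 ^ n" "q \<noteq> q'"
  shows "\<exists>y. (\<forall>u<2. \<forall>v<2. \<forall>x. Gdes (Suc n) (2 * q + u) (2 * q' + v) x = (if u = v then y x else 0)) \<and>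
    (if \<exists>j<n. xor q q' = 2 ^ j then var_entry (n + 2) y else y = (\<lambda>x. 0))"
  using assms
proof (induction n arbitrary: q q')
  case 0
  then show ?case by simp
next
  case (Suc n)
  have lt: "2 * t + u < 2 ^ Suc n" if "t < 2 ^ n" "u < 2" for t u :: nat
    using that by simp
  have sh: "2 * (t + 2 ^ n) + u = (2 * t + u) + 2 ^ Suc n" for t u :: nat by simp
  have eq2: "2 * t + u = 2 * t' + v \<longleftrightarrow> t = t' \<and> u = v" if "u < 2" "v < 2" for t t' u v :: nat
    using that by presburger
  have pow: "(\<exists>j<Suc n. xor t t' = 2 ^ j) \<longleftrightarrow> (\<exists>j<n. xor t t' = 2 ^ j)" if "t < 2 ^ n" "t' < 2 ^ n" for t t' :: nat
    using xor_less_power [OF that] by (auto simp: less_Suc_eq)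
  \<comment> \<open>The top bit is already set, so the sum is a single power of two only if all
    lower bits agree.\<close>
  have pow': "(\<exists>j<Suc n. xor t t' + 2 ^ n = 2 ^ j) \<longleftrightarrow> t = t'" if "t < 2 ^ n" "t' < 2 ^ n" for t t' :: nat
  proof
    assume "\<exists>j<Suc n. xor t t' + 2 ^ n = 2 ^ j"
    then obtain j where j: "j < Suc n" "xor t t' + 2 ^ n = 2 ^ j" by blast
    then have "(2::nat) ^ j \<le> 2 ^ n" by (intro power_increasing) auto
    then have "xor t t' = 0" using j by linarith
    then show "t = t'" by (simp add: xor_eq_0_iff)
  qed auto
  have vx: "var_entry (Suc n + 2) (\<lambda>x. - cnj (x (Suc n + 2)))" "var_entry (Suc n + 2) (\<lambda>x. x (Suc n + 2))"
    unfolding var_entry_def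
     apply (intro bexI [of _ "Suc n + 2"] exI [of _ "-1"] exI [of _ True]; simp)
    apply (intro bexI [of _ "Suc n + 2"] exI [of _ 1] exI [of _ False]; simp)
    done
  show ?case
  proof (cases rule: less_Suc_power_cases [OF Suc.prems(1)]; cases rule: less_Suc_power_cases [OF Suc.prems(2)])
    assume q: "q < 2 ^ n" "q' < 2 ^ n"
    from Suc.IH [OF q Suc.prems(3)] obtain y where y:
      "\<forall>u<2. \<forall>v<2. \<forall>x. Gdes (Suc n) (2 * q + u) (2 * q' + v) x = (if u = v then y x else 0)"
      "if \<exists>j<n. xor q q' = 2 ^ j then var_entry (n + 2) y else y = (\<lambda>x. 0)" by blast
    have G: "Gdes (Suc (Suc n)) (2 * q + u) (2 * q' + v) x = Gdes (Suc n) (2 * q + u) (2 * q' + v) x"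
      if "u < 2" "v < 2" for u v x
      by (intro Gdes_blocks lt q that)
    show ?thesis
    proof (intro exI [of _ y] conjI)
      show "\<forall>u<2. \<forall>v<2. \<forall>x. Gdes (Suc (Suc n)) (2 * q + u) (2 * q' + v) x = (if u = v then y x else 0)"
        using y(1) by (simp add: G)
      show "if \<exists>j<Suc n. xor q q' = 2 ^ j then var_entry (Suc n + 2) y else y = (\<lambda>x. 0)"
        using y(2) var_entry_mono [of "n + 2" y "Suc n + 2"] unfolding pow [OF q] by (auto split: if_splits)
    qed
  next
    fix t
    assume q: "q < 2 ^ n" and t: "t < 2 ^ n" "q' = t + 2 ^ n"
    have G: "Gdes (Suc (Suc n)) (2 * q + u) (2 * q' + v) x =
        (if 2 * q + u = 2 * t + v then - cnj (x (Suc n + 2)) else 0)" if "u < 2" for u v x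
      unfolding t(2) sh by (intro Gdes_blocks lt q that)
    show ?thesis
      unfolding t(2) xor_power2_add(1) [OF q t(1)] pow' [OF q t(1)]
      unfolding t(2) [symmetric]
    proof (intro exI [of _ "if q = t then \<lambda>x. - cnj (x (Suc n + 2)) else (\<lambda>x. 0)"] conjI)
      show "\<forall>u<2. \<forall>v<2. \<forall>x. Gdes (Suc (Suc n)) (2 * q + u) (2 * q' + v) x =
         (if u = v then (if q = t then \<lambda>x. - cnj (x (Suc n + 2)) else (\<lambda>x. 0)) x else 0)"
      proof (intro allI impI)
        fix u v :: nat and x
        assume uv: "u < 2" "v < 2"
        show "Gdes (Suc (Suc n)) (2 * q + u) (2 * q' + v) x = (if u = v then (if q = t then \<lambda>x. - cnj (x (Suc n + 2)) else (\<lambda>x. 0)) x else 0)"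
          unfolding G [OF uv(1)] eq2 [OF uv] by auto
      qed
    qed (use vx in simp)
  next
    fix t
    assume t: "t < 2 ^ n" "q = t + 2 ^ n" and q: "q' < 2 ^ n"
    have G: "Gdes (Suc (Suc n)) (2 * q + u) (2 * q' + v) x =
        (if 2 * t + u = 2 * q' + v then x (Suc n + 2) else 0)" if "v < 2" for u v x
      unfolding t(2) sh by (intro Gdes_blocks lt q that)
    show ?thesis
      unfolding t(2) xor_power2_add(2) [OF q t(1)] pow' [OF q t(1)]
      unfolding t(2) [symmetric]
    proof (intro exI [of _ "if q' = t then \<lambda>x. x (Suc n + 2) else (\<lambda>x. 0)"] conjI)
      show "\<forall>u<2. \<forall>v<2. \<forall>x. Gdes (Suc (Suc n)) (2 * q + u) (2 * q' + v) x =
         (if u = v then (if q' = t then \<lambda>x. x (Suc n + 2) else (\<lambda>x. 0)) x else 0)"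
      proof (intro allI impI)
        fix u v :: nat and x
        assume uv: "u < 2" "v < 2"
        show "Gdes (Suc (Suc n)) (2 * q + u) (2 * q' + v) x = (if u = v then (if q' = t then \<lambda>x. x (Suc n + 2) else (\<lambda>x. 0)) x else 0)"
          unfolding G [OF uv(2)] eq2 [OF uv] by auto
      qed
    qed (use vx in simp)
  next
    \<comment> \<open>In the lower right quadrant the adjoint exchanges rows and columns, so the
      induction hypothesis is used with the block indices swapped.\<close>
    fix t t'
    assume t: "t < 2 ^ n" "q = t + 2 ^ n" and t': "t' < 2 ^ n" "q' = t' + 2 ^ n"
    then have "t' \<noteq> t" using Suc.prems(3) by auto
    from Suc.IH [OF t'(1) t(1) this] obtain y where y:
      "\<forall>u<2. \<forall>v<2. \<forall>x. Gdes (Suc n) (2 * t' + u) (2 * t + v) x = (if u = v then y x else 0)"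
      "if \<exists>j<n. xor t' t = 2 ^ j then var_entry (n + 2) y else y = (\<lambda>x. 0)" by blast
    have G: "Gdes (Suc (Suc n)) (2 * q + u) (2 * q' + v) x = cnj (Gdes (Suc n) (2 * t' + v) (2 * t + u) x)" for u v x
      unfolding t(2) t'(2) sh by (rule Gdes_blocks)
    show ?thesis
    proof (intro exI [of _ "\<lambda>x. cnj (y x)"] conjI)
      show "\<forall>u<2. \<forall>v<2. \<forall>x. Gdes (Suc (Suc n)) (2 * q + u) (2 * q' + v) x = (if u = v then cnj (y x) else 0)"
        using y(1) by (auto simp: G)
      show "if \<exists>j<Suc n. xor q q' = 2 ^ j then var_entry (Suc n + 2) (\<lambda>x. cnj (y x)) else (\<lambda>x. cnj (y x)) = (\<lambda>x. 0)"
        using y(2) var_entry_mono [OF var_entry_cnj, of "n + 2" y "Suc n + 2"]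
        unfolding t(2) t'(2) xor_power2_add(3) [OF t(1) t'(1)] pow [OF t(1) t'(1)] xor.commute [of t' t]
        by (auto split: if_splits)
    qed
  qed
qed

section \<open>The matrix \<open>W\<close> and multiplication by it\<close>

definition par :: "nat \<Rightarrow> nat \<Rightarrow> bool" where
  "par a r \<longleftrightarrow> odd (hw (r div 2 ^ (a - mpar a)))"

text \<open>The off-diagonal sign of \<open>H_2\<close> in row \<open>r\<close>. Column
  \<open>c\<close> carries the opposite sign, hence the minus sign at \<open>sg c\<close> in
  products with \<open>W\<close> from the right.\<close>

definition sg :: "nat \<Rightarrow> complex" where
  "sg r = (if even r then 1 else -1)"

text \<open>The blocks of \<open>W\<close> have even size because \<open>m < a\<close>, so
  \<open>r\<close> and \<open>xor r 1\<close> always lie in the same one, and the nested quotient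
  and remainder tests reduce to \<open>c = r\<close> or \<open>c = xor r 1\<close>.\<close>

lemma Wmat_eq:
  assumes a: "a \<ge> 1"
  shows "Wmat a r c = (if r = c then (if par a r then 1 / sqrt 2 else 1)
     else if par a r \<and> c = xor r 1 then (if odd r then -1 else 1) / sqrt 2 else 0)"
proof -
  define M :: nat where "M = 2 ^ (a - mpar a - 1)"
  obtain t where "a - mpar a = Suc t"
    using mpar_eqs(3) [OF a] by (metis Suc_diff_Suc)
  then have N: "2 ^ (a - mpar a) = 2 * M" by (simp add: M_def)
  have low: "r mod (2 * M) = 2 * (r div 2 mod M) + r mod 2" for r
    by (simp add: mod_mult2_eq)
  have 1: "r div (2 * M) = c div (2 * M) \<and> r mod (2 * M) = c mod (2 * M) \<longleftrightarrow> r = c"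
    by (metis div_mult_mod_eq)
  have 2: "r div (2 * M) = c div (2 * M) \<and> r mod (2 * M) div 2 = c mod (2 * M) div 2 \<longleftrightarrow> c = r \<or> c = xor r 1"
  proof -
    have "r mod (2 * M) div 2 = r div 2 mod M" for r by (simp add: low)
    moreover have "r div (2 * M) = c div (2 * M) \<and> r div 2 mod M = c div 2 mod M \<longleftrightarrow> r div 2 = c div 2"
      by (metis div_mult2_eq div_mult_mod_eq)
    ultimately show ?thesis using div2_eq_iff [of c r] by metis
  qed
  have 3: "r mod (2 * M) mod 2 = r mod 2" for r by (simp add: low)
  note 4 = xor_1_neq [of r]
  have W: "Wmat a r c = (if r div (2 * M) \<noteq> c div (2 * M) then 0
      else if \<not> par a r then (if r mod (2 * M) = c mod (2 * M) then 1 else 0)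
      else if r mod (2 * M) div 2 \<noteq> c mod (2 * M) div 2 then 0
      else (if odd r \<and> even c then -1 else 1) / sqrt 2)"
    unfolding Wmat_def Let_def N par_def 3 by (simp add: odd_iff_mod_2_eq_one even_iff_mod_2_eq_zero)
  consider "c = r" | "c = xor r 1" | "c \<noteq> r" "c \<noteq> xor r 1" by blast
  then show ?thesis
  proof cases
    case 1
    then show ?thesis unfolding W by simp
  next
    case 2
    then have "r \<noteq> c" "even c \<longleftrightarrow> odd r" using 4 by (auto simp: even_xor_iff)
    with 2 \<open>_ \<longleftrightarrow> r = c\<close> \<open>_ \<longleftrightarrow> c = r \<or> c = xor r 1\<close> show ?thesis
      unfolding W by presburger
  next
    case 3
    with \<open>_ \<longleftrightarrow> r = c\<close> \<open>_ \<longleftrightarrow> c = r \<or> c = xor r 1\<close> show ?thesis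
      unfolding W by presburger
  qed
qed

lemma par_xor_1:
  assumes a: "a \<ge> 1"
  shows "par a (xor r 1) = par a r"
proof -
  obtain t where "a - mpar a = Suc t"
    using mpar_eqs(3) [OF a] by (metis Suc_diff_Suc)
  moreover have "xor r 1 div 2 = r div 2"
    by (simp add: div2_eq_iff)
  ultimately show ?thesis by (simp add: par_def div_mult2_eq)
qed

lemma xor_1_less: "a \<ge> 1 \<Longrightarrow> r < 2 ^ a \<Longrightarrow> xor r 1 < 2 ^ a" for r :: nat
  by (intro xor_less_power) (auto intro: one_less_power simp del: One_nat_def)

lemma sum_two:
  fixes f :: "nat \<Rightarrow> complex"
  assumes "u < n" "v < n" "u \<noteq> v" "\<And>s. s < n \<Longrightarrow> s \<noteq> u \<Longrightarrow> s \<noteq> v \<Longrightarrow> f s = 0"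
  shows "(\<Sum>s<n. f s) = f u + f v"
proof -
  have "(\<Sum>s<n. f s) = sum f {u, v}"
    using assms by (intro sum.mono_neutral_right) auto
  then show ?thesis using assms(3) by simp
qed

lemma Wmat_row_sum:
  assumes a: "a \<ge> 1" and r: "r < 2 ^ a"
  shows "(\<Sum>s<2 ^ a. complex_of_real (Wmat a r s) * X s) =
    (if par a r then (X r + sg r * X (xor r 1)) / of_real (sqrt 2) else X r)"
proof -
  have "r \<noteq> xor r 1" by (rule xor_1_neq [symmetric])
  then have "(\<Sum>s<2 ^ a. complex_of_real (Wmat a r s) * X s) =
      complex_of_real (Wmat a r r) * X r + complex_of_real (Wmat a r (xor r 1)) * X (xor r 1)"
    using r xor_1_less [OF a r] by (intro sum_two) (auto simp: Wmat_eq [OF a])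
  also have "\<dots> = (if par a r then (X r + sg r * X (xor r 1)) / of_real (sqrt 2) else X r)"
    using \<open>r \<noteq> xor r 1\<close> by (auto simp: Wmat_eq [OF a] sg_def add_divide_distrib diff_divide_distrib)
  finally show ?thesis .
qed

lemma Wmat_col_sum:
  assumes a: "a \<ge> 1" and c: "c < 2 ^ a"
  shows "(\<Sum>s<2 ^ a. X s * complex_of_real (Wmat a s c)) =
    (if par a c then (X c - sg c * X (xor c 1)) / of_real (sqrt 2) else X c)"
proof -
  have "c \<noteq> xor c 1" by (rule xor_1_neq [symmetric])
  have inv: "c = xor s 1 \<longleftrightarrow> s = xor c 1" for s
    by (metis xor.assoc xor.right_neutral xor_self_eq)
  have od: "odd (xor c 1) \<longleftrightarrow> even c" by (simp add: even_xor_iff)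
  have "(\<Sum>s<2 ^ a. X s * complex_of_real (Wmat a s c)) =
      X c * complex_of_real (Wmat a c c) + X (xor c 1) * complex_of_real (Wmat a (xor c 1) c)"
    using c xor_1_less [OF a c] \<open>c \<noteq> xor c 1\<close> by (intro sum_two) (auto simp: Wmat_eq [OF a] xor.assoc)
  also have "\<dots> = (if par a c then (X c - sg c * X (xor c 1)) / of_real (sqrt 2) else X c)"
    using \<open>c \<noteq> xor c 1\<close> par_xor_1 [OF a, of c] inv [of "xor c 1"] od
    by (auto simp: Wmat_eq [OF a] sg_def add_divide_distrib diff_divide_distrib)
  finally show ?thesis .
qed

lemma Kdes_eq:
  assumes a: "a \<ge> 1" and r: "r < 2 ^ a" and c: "c < 2 ^ a"
  defines "Y \<equiv> \<lambda>s x. if par a c then (Gdes a s c x - sg c * Gdes a s (xor c 1) x) / of_real (sqrt 2) else Gdes a s c x"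
  shows "Kdes a r c x = (if par a r then (Y r x + sg r * Y (xor r 1) x) / of_real (sqrt 2) else Y r x)"
proof -
  have "Kdes a r c x = (\<Sum>s<2 ^ a. complex_of_real (Wmat a r s) * (\<Sum>t<2 ^ a. Gdes a s t x * complex_of_real (Wmat a t c)))"
    by (simp add: Kdes_def sum_distrib_left mult.assoc)
  also have "\<dots> = (\<Sum>s<2 ^ a. complex_of_real (Wmat a r s) * Y s x)"
    by (simp add: Wmat_col_sum [OF a c] Y_def)
  also have "\<dots> = (if par a r then (Y r x + sg r * Y (xor r 1) x) / of_real (sqrt 2) else Y r x)"
    by (rule Wmat_row_sum [OF a r])
  finally show ?thesis .
qed

section \<open>Admissible entries and the entries of \<open>K\<close>\<close>

lemma cis_entryI:
  assumes "i \<in> {1..nv}" "k \<in> {1..nv}" "s = 1 \<or> s = -1"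
    and "\<And>x. e x = complex_of_real (s / sqrt (2 ^ l)) *
        (if cj then cnj (Complex (Re (x i)) (Im (x k))) else Complex (Re (x i)) (Im (x k)))"
  shows "cis_entry nv e"
  unfolding cis_entry_def
  by (intro exI [of _ i] exI [of _ k] exI [of _ s] exI [of _ l] exI [of _ cj] conjI assms allI)

lemma cis_entry_scale:
  assumes "cis_entry nv e" and "s = 1 \<or> s = -1"
  shows "cis_entry nv (\<lambda>x. complex_of_real (s / sqrt (2 ^ l)) * e x)"
proof -
  from assms(1) obtain i k s' l' cj where e: "i \<in> {1..nv}" "k \<in> {1..nv}" "s' = 1 \<or> s' = -1"
    "\<And>x. e x = complex_of_real (s' / sqrt (2 ^ l')) *
        (if cj then cnj (Complex (Re (x i)) (Im (x k))) else Complex (Re (x i)) (Im (x k)))"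
    unfolding cis_entry_def by blast
  show ?thesis
  proof (rule cis_entryI [OF e(1,2), of "s * s'" _ "l + l'" cj])
    show "s * s' = 1 \<or> s * s' = -1" using e(3) assms(2) by auto
    show "complex_of_real (s / sqrt (2 ^ l)) * e x = complex_of_real (s * s' / sqrt (2 ^ (l + l'))) *
        (if cj then cnj (Complex (Re (x i)) (Im (x k))) else Complex (Re (x i)) (Im (x k)))" for x
      unfolding e(4) mult.assoc [symmetric]
      by (simp only: of_real_mult [symmetric]) (simp add: power_add real_sqrt_mult)
  qed
qed

lemma cis_entry_var:
  assumes "var_entry nv y"
  shows "cis_entry nv y"
proof -
  from assms obtain i s cj where "i \<in> {1..nv}" "s = 1 \<or> s = -1"
     "\<And>x. y x = complex_of_real s * (if cj then cnj (x i) else x i)"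
    unfolding var_entry_def by blast
  then show ?thesis by (intro cis_entryI [of i nv i s _ 0 cj]) auto
qed

lemma cis_entry_nonzero:
  assumes "cis_entry nv e"
  shows "e \<noteq> (\<lambda>x. 0)"
proof
  assume e0: "e = (\<lambda>x. 0)"
  from assms obtain i k s l cj where e: "s = 1 \<or> s = -1"
    "\<And>x. e x = complex_of_real (s / sqrt (2 ^ l)) *
        (if cj then cnj (Complex (Re (x i)) (Im (x k))) else Complex (Re (x i)) (Im (x k)))"
    unfolding cis_entry_def by blast
  \<comment> \<open>If all variables are 1, every interleaved variable is 1 too, and
    \<open>e\<close> becomes a nonzero scalar.\<close>
  show False using e(1) e(2) [of "\<lambda>_. 1"] by (auto simp: e0 complex_eq_iff split: if_splits)
qed

text \<open>Row and column share the block parity, so \<open>W\<close> acts on both sides of this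
  block or on neither. Its two factors \<open>1 / sqrt 2\<close> give \<open>1 / 2\<close>, which
  cancels against sums and differences of a variable and its conjugate; all scales are therefore
  1.\<close>

lemma Kdes_diag_block:
  assumes a: "a \<ge> 1" and r: "r < 2 ^ a" and c: "c < 2 ^ a" and q: "r div 2 = c div 2"
  shows "cis_entry (a + 1) (Kdes a r c)"
proof -
  obtain n where n: "a = Suc n" using a by (cases a) auto
  define q u v where "q = r div 2" and "u = r mod 2" and "v = c mod 2"
  have rc: "r = 2 * q + u" "c = 2 * q + v" by (simp add: q_def u_def) (simp add: q_def v_def q)
  have uv: "u = 0 \<or> u = 1" "v = 0 \<or> v = 1" by (auto simp: u_def v_def)
  have x1: "xor (2 * q + w) 1 = 2 * q + (1 - w)" if "w = 0 \<or> w = 1" for w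
    using that by (auto simp: xor_1_nat simp del: One_nat_def)
  have sg: "sg r = (if u = 0 then 1 else -1)" "sg c = (if v = 0 then 1 else -1)"
    unfolding rc using uv by (auto simp: sg_def)
  have pc: "par a (2 * q + v) = par a (2 * q + u)"
    using q par_xor_1 [OF a, of r] div2_eq_iff [of c r] rc by metis
  define p where "p = par a (2 * q + u)"
  have "q < 2 ^ n" using r by (simp add: q_def n)
  have K: "Kdes a r c x = (if p then (G u v - sg c * G u (1 - v) + sg r * (G (1 - u) v - sg c * G (1 - u) (1 - v))) / 2 else G u v)"
    if "\<And>u v. u < 2 \<Longrightarrow> v < 2 \<Longrightarrow> Gdes a (2 * q + u) (2 * q + v) x = G u v" for G x
  proof -
    have "u < 2" "v < 2" "1 - u < 2" "1 - v < 2" using uv by auto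
    have s2: "complex_of_real (sqrt 2) * complex_of_real (sqrt 2) = 2"
      by (simp flip: of_real_mult)
    have aux: "(A / of_real (sqrt 2) + s * (B / of_real (sqrt 2))) / complex_of_real (sqrt 2) = (A + s * B) / 2" for A B s
      by (simp add: add_divide_distrib s2)
    have p: "par a r = p" "par a c = p" using pc unfolding rc p_def by simp_all
    have xr: "xor r 1 = 2 * q + (1 - u)" "xor c 1 = 2 * q + (1 - v)"
      unfolding rc by (rule x1 [OF uv(1)], rule x1 [OF uv(2)])
    have g: "Gdes a r c x = G u v" "Gdes a r (xor c 1) x = G u (1 - v)"
       "Gdes a (xor r 1) c x = G (1 - u) v" "Gdes a (xor r 1) (xor c 1) x = G (1 - u) (1 - v)"
      unfolding xr unfolding rc by (intro that; fact)+
    show ?thesis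
      unfolding Kdes_eq [OF a r c] p g by (cases p) (simp_all only: if_True if_False aux)
  qed
  have G1: "Gdes 1 0 0 x = x 1" "Gdes 1 0 1 x = - cnj (x 2)" "Gdes 1 1 0 x = x 2" "Gdes 1 1 1 x = cnj (x 1)" for x
    by (simp_all add: Gdes.simps Let_def numeral_2_eq_2)
  note G1' = G1 [simplified One_nat_def]
  have nv: "1 \<in> {1..a + 1}" "2 \<in> {1..a + 1}" using a by auto
  from Gdes_diag_block [OF \<open>q < 2 ^ n\<close>] consider
     "\<And>u v x. u < 2 \<Longrightarrow> v < 2 \<Longrightarrow> Gdes a (2 * q + u) (2 * q + v) x = Gdes 1 u v x"
   | "\<And>u v x. u < 2 \<Longrightarrow> v < 2 \<Longrightarrow> Gdes a (2 * q + u) (2 * q + v) x = cnj (Gdes 1 v u x)"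
    unfolding n by blast
  \<comment> \<open>If \<open>p\<close> holds, the block is \<open>R G R\<close> with \<open>R\<close> the rotation by 45 degrees; this interleaves
    the coordinates of \<open>x 1\<close> and \<open>x 2\<close>.\<close>
  then show ?thesis
  proof cases
    case 1
    note K1 = K [OF 1]
    consider "\<not> p" "u = 0" "v = 0" | "\<not> p" "u = 0" "v = 1" | "\<not> p" "u = 1" "v = 0" | "\<not> p" "u = 1" "v = 1"
      | "p" "u = 0" "v = 0" | "p" "u = 0" "v = 1" | "p" "u = 1" "v = 0" | "p" "u = 1" "v = 1"
      using uv by blast
    then show ?thesis
      \<comment> \<open>In each rule the two facts \<open>nv\<close> select the variables of the
        real and the imaginary part; then follow the sign, the exponent 0 of the scale and the
        conjugation flag.\<close>
      apply cases
      apply (rule cis_entryI [OF nv(1) nv(1), of 1 _ 0 False]; simp add: K1 sg G1 G1' complex_eq_iff)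
      apply (rule cis_entryI [OF nv(2) nv(2), of "-1" _ 0 True]; simp add: K1 sg G1 G1' complex_eq_iff)
      apply (rule cis_entryI [OF nv(2) nv(2), of 1 _ 0 False]; simp add: K1 sg G1 G1' complex_eq_iff)
      apply (rule cis_entryI [OF nv(1) nv(1), of 1 _ 0 True]; simp add: K1 sg G1 G1' complex_eq_iff)
      apply (rule cis_entryI [OF nv(2) nv(1), of 1 _ 0 False]; simp add: K1 sg G1 G1' complex_eq_iff)
      apply (rule cis_entryI [OF nv(1) nv(2), of 1 _ 0 False]; simp add: K1 sg G1 G1' complex_eq_iff)
      apply (rule cis_entryI [OF nv(1) nv(2), of "-1" _ 0 True]; simp add: K1 sg G1 G1' complex_eq_iff)
      apply (rule cis_entryI [OF nv(2) nv(1), of 1 _ 0 True]; simp add: K1 sg G1 G1' complex_eq_iff)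
      done
  next
    case 2
    note K2 = K [OF 2]
    consider "\<not> p" "u = 0" "v = 0" | "\<not> p" "u = 0" "v = 1" | "\<not> p" "u = 1" "v = 0" | "\<not> p" "u = 1" "v = 1"
      | "p" "u = 0" "v = 0" | "p" "u = 0" "v = 1" | "p" "u = 1" "v = 0" | "p" "u = 1" "v = 1"
      using uv by blast
    then show ?thesis
      apply cases
      apply (rule cis_entryI [OF nv(1) nv(1), of 1 _ 0 True]; simp add: K2 sg G1 G1' complex_eq_iff)
      apply (rule cis_entryI [OF nv(2) nv(2), of "1" _ 0 True]; simp add: K2 sg G1 G1' complex_eq_iff)
      apply (rule cis_entryI [OF nv(2) nv(2), of "-1" _ 0 False]; simp add: K2 sg G1 G1' complex_eq_iff)
      apply (rule cis_entryI [OF nv(1) nv(1), of 1 _ 0 False]; simp add: K2 sg G1 G1' complex_eq_iff)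
      apply (rule cis_entryI [OF nv(2) nv(1), of "-1" _ 0 False]; simp add: K2 sg G1 G1' complex_eq_iff)
      apply (rule cis_entryI [OF nv(1) nv(2), of 1 _ 0 True]; simp add: K2 sg G1 G1' complex_eq_iff)
      apply (rule cis_entryI [OF nv(1) nv(2), of "-1" _ 0 False]; simp add: K2 sg G1 G1' complex_eq_iff)
      apply (rule cis_entryI [OF nv(2) nv(1), of "-1" _ 0 True]; simp add: K2 sg G1 G1' complex_eq_iff)
      done
  qed
qed

text \<open>The indices differ in bit \<open>j + 1\<close> and possibly in bit 0. The latter lies
  inside the blocks of \<open>W\<close>; the former changes the block index, and then in a single
  bit, exactly if \<open>j + 1 >= a - m\<close>.\<close>

lemma par_xor_power2:
  assumes a: "a \<ge> 1" and j: "xor r c div 2 = 2 ^ j"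
  shows "par a r = par a c \<longleftrightarrow> j + 1 < a - mpar a"
proof -
  obtain t where t: "a - mpar a = Suc t"
    using mpar_eqs(3) [OF a] by (metis Suc_diff_Suc)
  have "xor r c div 2 ^ Suc t = 2 ^ j div 2 ^ t"
    by (simp add: div_mult2_eq j)
  then have "odd (hw (xor (r div 2 ^ Suc t) (c div 2 ^ Suc t))) \<longleftrightarrow> odd (hw (2 ^ j div 2 ^ t))"
    by (simp only: xor_div_power)
  moreover have "odd (hw (2 ^ j div 2 ^ t)) \<longleftrightarrow> t \<le> j"
  proof (cases "t \<le> j")
    case True
    then show ?thesis by (simp add: power_diff [symmetric] hw_power2)
  next
    case False
    then have "(2::nat) ^ j < 2 ^ t" by simp
    then show ?thesis using False by simp
  qed
  ultimately show ?thesis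
    unfolding odd_hw_xor par_def t by auto
qed

text \<open>Let \<open>R\<close> be \<open>H_2 / sqrt 2\<close>, a rotation by 45 degrees. The block
  of \<open>G\<close> is \<open>y\<close> times the identity; it stays so if both parities are even,
  becomes \<open>y R R\<close>, a quarter turn with zero diagonal, if both are odd, and
  \<open>y R\<close> with all four positions filled if they differ. This is the pattern that
  \<open>in_support\<close> encodes.\<close>

lemma Kdes_off_diag_block:
  assumes a: "a \<ge> 1" and r: "r < 2 ^ a" and c: "c < 2 ^ a" and q: "r div 2 \<noteq> c div 2"
  shows "if in_support a (par a c) (xor r c) then cis_entry (a + 1) (Kdes a r c) else Kdes a r c = (\<lambda>x. 0)"
proof -
  obtain n where n: "a = Suc n" using a by (cases a) auto
  have q': "r div 2 < 2 ^ n" "c div 2 < 2 ^ n" using r c by (simp_all add: n)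
  obtain y where y: "\<And>u v x. u < 2 \<Longrightarrow> v < 2 \<Longrightarrow> Gdes a (2 * (r div 2) + u) (2 * (c div 2) + v) x = (if u = v then y x else 0)"
    "if \<exists>j<n. xor (r div 2) (c div 2) = 2 ^ j then var_entry (n + 2) y else y = (\<lambda>x. 0)"
    using Gdes_off_diag_block [OF q' q] unfolding n by blast
  have G: "Gdes a s t x = (if even s = even t then y x else 0)" if "s div 2 = r div 2" "t div 2 = c div 2" for s t x
    using y(1) [of "s mod 2" "t mod 2" x] that
    by (metis div_mult_mod_eq mult.commute mod_less_divisor pos2 even_iff_mod_2_eq_zero not_mod_2_eq_0_eq_1)
  have d: "xor s 1 div 2 = s div 2" for s :: nat by (simp add: div2_eq_iff)
  have ev: "even (xor s 1) \<longleftrightarrow> odd s" for s :: nat by (simp add: even_xor_iff)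
  have s2: "complex_of_real (sqrt 2) * complex_of_real (sqrt 2) = 2"
    by (simp flip: of_real_mult)
  have K: "Kdes a r c x =
    (if par a r = par a c then
       if par a c then (if even r = even c then 0 else sg r * y x)
       else (if even r = even c then y x else 0)
     else if par a r then (if even r = even c then y x else sg r * y x) / of_real (sqrt 2)
     else (if even r = even c then y x else - sg c * y x) / of_real (sqrt 2))" for x
    unfolding Kdes_eq [OF a r c]
    by (auto simp: G d [simplified] ev [simplified] sg_def s2)
  show ?thesis
  proof (cases "\<exists>j<n. xor r c div 2 = 2 ^ j")
    case False
    then have "y = (\<lambda>x. 0)" using y(2) by (auto simp: xor_div2)
    moreover have "xor r c div 2 \<noteq> 0" using q by (simp add: xor_div2 xor_eq_0_iff)
    then have "\<not> in_support a (par a c) (xor r c)"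
      using False by (auto simp: in_support_def n)
    ultimately show ?thesis using K by auto
  next
    case True
    then obtain j where j: "j < n" "xor r c div 2 = 2 ^ j" by blast
    have supp: "in_support a (par a c) (xor r c) \<longleftrightarrow> (par a r = par a c \<longrightarrow> (even r \<noteq> even c) = par a c)"
      using j par_xor_power2 [OF a j(2)] by (auto simp: in_support_def n even_xor_iff)
    have y2: "cis_entry (a + 1) y"
      using True y(2) by (intro cis_entry_var) (auto simp: xor_div2 n)
    have scaled: "cis_entry (a + 1) (Kdes a r c)" if "s = 1 \<or> s = -1" "\<And>x. Kdes a r c x = complex_of_real (s / sqrt (2 ^ l)) * y x" for s l
      using cis_entry_scale [OF y2 that(1), of l] that(2) by (simp add: fun_eq_iff cis_entry_def)
    show ?thesis
    proof (cases "in_support a (par a c) (xor r c)")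
      case False
      then have "Kdes a r c x = 0" for x unfolding K supp by auto
      then show ?thesis using False by auto
    next
      case True
      define s l where "s = (if even r = even c then 1 else if par a r then (if even r then 1 else -1) else if even c then -1 else 1 :: real)"
        and "l = (if par a r = par a c then 0 else 1 :: nat)"
      have "cis_entry (a + 1) (Kdes a r c)"
      proof (rule scaled)
        show "s = 1 \<or> s = -1" by (auto simp: s_def)
        show "Kdes a r c x = complex_of_real (s / sqrt (2 ^ l)) * y x" for x
          using True unfolding K supp by (auto simp: s_def l_def sg_def)
      qed
      then show ?thesis using True by simp
    qed
  qed
qed

lemma Kdes_support:
  assumes "a \<ge> 1" and "r < 2 ^ a" and "c < 2 ^ a"
  shows "if in_support a (par a c) (xor r c) then cis_entry (a + 1) (Kdes a r c) else Kdes a r c = (\<lambda>x. 0)"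
proof (cases "r div 2 = c div 2")
  case True
  then have "in_support a (par a c) (xor r c)"
    by (simp add: in_support_def xor_div2)
  then show ?thesis using Kdes_diag_block [OF assms True] by simp
qed (rule Kdes_off_diag_block [OF assms])

section \<open>Cosets and the design L\<close>

text \<open>Summing over \<open>k\<close> first removes all mixed terms of the double sum. The
  factor \<open>m\<close> covers both uses: it is 1 for \<open>W\<close> and the order of the matrix
  for \<open>H\<close>.\<close>

lemma sum_cnj_isometry:
  fixes U :: "nat \<Rightarrow> nat \<Rightarrow> real" and f g :: "nat \<Rightarrow> complex"
  assumes U: "\<And>s t. s < n \<Longrightarrow> t < n \<Longrightarrow> (\<Sum>k<n. U k s * U k t) = (if s = t then m else 0)"
  shows "(\<Sum>k<n. cnj (\<Sum>s<n. of_real (U k s) * f s) * (\<Sum>t<n. of_real (U k t) * g t)) =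
    of_real m * (\<Sum>s<n. cnj (f s) * g s)"
proof -
  have "(\<Sum>k<n. cnj (\<Sum>s<n. of_real (U k s) * f s) * (\<Sum>t<n. of_real (U k t) * g t)) =
    (\<Sum>k<n. \<Sum>s<n. \<Sum>t<n. of_real (U k s * U k t) * (cnj (f s) * g t))"
    unfolding cnj_sum sum_product by (simp add: mult_ac)
  also have "\<dots> = (\<Sum>s<n. \<Sum>k<n. \<Sum>t<n. of_real (U k s * U k t) * (cnj (f s) * g t))"
    by (rule sum.swap)
  also have "\<dots> = (\<Sum>s<n. \<Sum>t<n. \<Sum>k<n. of_real (U k s * U k t) * (cnj (f s) * g t))"
    by (intro sum.cong refl sum.swap)
  also have "\<dots> = (\<Sum>s<n. \<Sum>t<n. of_real (if s = t then m else 0) * (cnj (f s) * g t))"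
  proof (intro sum.cong refl)
    fix s t assume "s \<in> {..<n}" "t \<in> {..<n}"
    then have "(\<Sum>k<n. complex_of_real (U k s * U k t)) = of_real (if s = t then m else 0)"
      using U [of s t] by (simp only: of_real_sum [symmetric] lessThan_iff)
    then show "(\<Sum>k<n. of_real (U k s * U k t) * (cnj (f s) * g t)) = of_real (if s = t then m else 0) * (cnj (f s) * g t)"
      by (simp only: sum_distrib_right [symmetric])
  qed
  also have "\<dots> = (\<Sum>s<n. \<Sum>t<n. if s = t then of_real m * (cnj (f s) * g t) else 0)"
    by (intro sum.cong) auto
  also have "\<dots> = of_real m * (\<Sum>s<n. cnj (f s) * g s)"
    by (simp add: sum_distrib_left)
  finally show ?thesis .
qed

lemma Wmat_orthogonal:
  assumes a: "a \<ge> 1" and t: "t < 2 ^ a" and c: "c < 2 ^ a"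
  shows "(\<Sum>s<2 ^ a. Wmat a s t * Wmat a s c) = (if t = c then 1 else 0)"
proof -
  define d where "d = xor c 1"
  have d: "xor c 1 = d" "xor d 1 = c" "d \<noteq> c" "odd d \<longleftrightarrow> even c" "par a d = par a c"
    using xor_1_neq [of c] par_xor_1 [OF a, of c] by (simp_all add: d_def xor.assoc even_xor_iff)
  have s2: "complex_of_real (sqrt 2) * complex_of_real (sqrt 2) = 2"
    by (simp flip: of_real_mult)
  then have s2': "2 / complex_of_real (sqrt 2) = of_real (sqrt 2)"
    by (simp add: divide_eq_eq)
  have "complex_of_real (\<Sum>s<2 ^ a. Wmat a s t * Wmat a s c) =
      (\<Sum>s<2 ^ a. of_real (Wmat a s t) * of_real (Wmat a s c))" by simp
  also have "\<dots> = (if par a c then (of_real (Wmat a c t) - sg c * of_real (Wmat a d t)) / of_real (sqrt 2)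
      else of_real (Wmat a c t))"
    unfolding d_def by (rule Wmat_col_sum [OF a c])
  also have "\<dots> = (if t = c then 1 else 0)"
  proof -
    consider "t = c" | "t = d" | "t \<noteq> c" "t \<noteq> d" by blast
    then show ?thesis
      unfolding Wmat_eq [OF a] d(1,2,5)
      by cases (use d(3,4) in \<open>auto simp: sg_def s2' simp flip: add_divide_distrib\<close>)
  qed
  finally show ?thesis
    by (metis of_real_0 of_real_1 of_real_eq_iff)
qed

text \<open>The left factor \<open>W\<close> of \<open>K\<close> is an isometry and drops out, the
  orthogonality of \<open>G\<close> leaves a multiple of the transpose of \<open>W\<close> times
  \<open>W\<close>, and that product is again the identity.\<close>

lemma Kdes_orthogonal:
  assumes a: "a \<ge> 1" and i: "i < 2 ^ a" and j: "j < 2 ^ a"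
  shows "(\<Sum>k<2 ^ a. cnj (Kdes a k i x) * Kdes a k j x) =
    (if i = j then complex_of_real (\<Sum>l\<in>{1..a + 1}. (cmod (x l))\<^sup>2) else 0)"
proof -
  define nx where "nx = (\<Sum>l\<in>{1..a + 1}. (cmod (x l))\<^sup>2)"
  define Y where "Y c s = (\<Sum>t<2 ^ a. Gdes a s t x * of_real (Wmat a t c))" for c s
  have K: "Kdes a r c x = (\<Sum>s<2 ^ a. of_real (Wmat a r s) * Y c s)" for r c
    by (simp add: Kdes_def Y_def sum_distrib_left mult.assoc)
  have "(\<Sum>k<2 ^ a. cnj (Kdes a k i x) * Kdes a k j x) = of_real 1 * (\<Sum>s<2 ^ a. cnj (Y i s) * Y j s)"
    unfolding K by (rule sum_cnj_isometry) (rule Wmat_orthogonal [OF a])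
  also have "\<dots> = (\<Sum>s<2 ^ a. \<Sum>t<2 ^ a. \<Sum>u<2 ^ a. of_real (Wmat a t i * Wmat a u j) * (cnj (Gdes a s t x) * Gdes a s u x))"
    unfolding Y_def cnj_sum sum_product by (simp add: mult_ac)
  also have "\<dots> = (\<Sum>t<2 ^ a. \<Sum>s<2 ^ a. \<Sum>u<2 ^ a. of_real (Wmat a t i * Wmat a u j) * (cnj (Gdes a s t x) * Gdes a s u x))"
    by (rule sum.swap)
  also have "\<dots> = (\<Sum>t<2 ^ a. \<Sum>u<2 ^ a. \<Sum>s<2 ^ a. of_real (Wmat a t i * Wmat a u j) * (cnj (Gdes a s t x) * Gdes a s u x))"
    by (intro sum.cong refl sum.swap)
  also have "\<dots> = (\<Sum>t<2 ^ a. \<Sum>u<2 ^ a. if t = u then of_real (Wmat a t i * Wmat a u j) * of_real nx else 0)"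
  proof (intro sum.cong refl)
    fix t u :: nat assume "t \<in> {..<2 ^ a}" "u \<in> {..<2 ^ a}"
    then show "(\<Sum>s<2 ^ a. of_real (Wmat a t i * Wmat a u j) * (cnj (Gdes a s t x) * Gdes a s u x)) =
       (if t = u then of_real (Wmat a t i * Wmat a u j) * of_real nx else 0)"
      using Gdes_orthogonal(1) [of t a u x]
      by (simp only: sum_distrib_left [symmetric] lessThan_iff nx_def [symmetric]) auto
  qed
  also have "\<dots> = (\<Sum>t<2 ^ a. of_real (Wmat a t i * Wmat a t j) * of_real nx)"
    by simp
  also have "\<dots> = of_real (\<Sum>t<2 ^ a. Wmat a t i * Wmat a t j) * of_real nx"
    by (simp add: sum_distrib_right)
  finally show ?thesis
    by (simp add: Wmat_orthogonal [OF a i j] nx_def)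
qed

section \<open>Cosets of \<open>S\<close>\<close>

lemma Sspace_zero: "0 \<in> Sspace a"
  by (simp add: Sspace_def xor_span.zero)

lemma coset_eq:
  assumes "u \<in> xor y ` Sspace a"
  shows "xor y ` Sspace a = xor u ` Sspace a"
proof -
  obtain s where s: "s \<in> Sspace a" "u = xor y s" using assms by auto
  have closed: "xor s v \<in> Sspace a" if "v \<in> Sspace a" for v
    using s(1) that unfolding Sspace_def by (rule xor_span_closed)
  show ?thesis
  proof (intro equalityI image_subsetI)
    fix v assume v: "v \<in> Sspace a"
    show "xor y v \<in> xor u ` Sspace a" "xor u v \<in> xor y ` Sspace a"
      by (rule image_eqI [OF _ closed [OF v]], simp add: s(2) xor.assoc)+
  qed
qed

lemma cosets_disjoint:
  assumes "A \<in> cosets a" "B \<in> cosets a" "A \<noteq> B"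
  shows "A \<inter> B = {}"
proof (rule ccontr)
  assume "A \<inter> B \<noteq> {}"
  then obtain u where "u \<in> A" "u \<in> B" by blast
  moreover obtain y z where "A = xor y ` Sspace a" "B = xor z ` Sspace a"
    using assms(1,2) by (auto simp: cosets_def)
  ultimately show False
    using assms(3) coset_eq [of u y a] coset_eq [of u z a] by simp
qed

lemma coset_props:
  assumes a: "a \<ge> 1" and A: "A \<in> cosets a" and u: "u \<in> A"
  shows "u < 2 ^ a" and "v \<in> A \<Longrightarrow> syndrome a u = syndrome a v"
proof -
  obtain y where y: "y < 2 ^ a" "A = xor y ` Sspace a" using A by (auto simp: cosets_def)
  show "u < 2 ^ a"
    using u y Sspace_props(1) [OF a] by (auto intro: xor_less_power)
  show "syndrome a u = syndrome a v" if "v \<in> A"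
    using u that Sspace_props(2) [OF a] by (auto simp: y syndrome_xor)
qed

lemma Union_cosets:
  assumes "a \<ge> 1"
  shows "\<Union> (cosets a) = {..<2 ^ a}"
proof (intro equalityI subsetI)
  fix u assume "u \<in> {..<2 ^ a :: nat}"
  moreover have "u \<in> xor u ` Sspace a" using Sspace_zero [of a] by (metis image_eqI xor.right_neutral)
  ultimately show "u \<in> \<Union> (cosets a)" by (auto simp: cosets_def)
qed (use coset_props(1) [OF assms] in auto)

text \<open>Elements \<open>d z\<close> of the support with the \<open>2 ^ b\<close> distinct
  syndromes \<open>z\<close>, translated by \<open>c\<close>, lie in distinct cosets. By the assumed
  number of cosets every coset is met, and injectivity of the syndrome on the support gives
  uniqueness.\<close>

lemma coset_meets_support:
  assumes a: "a \<ge> 1" and card: "card (cosets a) = 2 ^ bpar a" and A: "A \<in> cosets a" and c: "c < 2 ^ a"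
  shows "\<exists>!r. r \<in> A \<and> in_support a (par a c) (xor r c)"
proof -
  have "\<forall>z. \<exists>d. z < 2 ^ bpar a \<longrightarrow> d < 2 ^ a \<and> in_support a (par a c) d \<and> syndrome a d = z"
    using syndrome_surj_on_support [OF a] by metis
  then obtain d where d: "\<And>z. z < 2 ^ bpar a \<Longrightarrow> d z < 2 ^ a \<and> in_support a (par a c) (d z) \<and> syndrome a (d z) = z"
    by metis
  define F where "F z = xor (xor c (d z)) ` Sspace a" for z
  have mem: "xor c (d z) \<in> F z" for z
    unfolding F_def using Sspace_zero [of a] by (metis image_eqI xor.right_neutral)
  have F: "F z \<in> cosets a" if "z < 2 ^ bpar a" for z
    using d [OF that] c by (auto simp: F_def cosets_def intro: xor_less_power)
  have "inj_on F {..<2 ^ bpar a}"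
  proof (rule inj_onI)
    fix z z' assume z: "z \<in> {..<2 ^ bpar a :: nat}" "z' \<in> {..<2 ^ bpar a}" and "F z = F z'"
    then have "syndrome a (xor c (d z)) = syndrome a (xor c (d z'))"
      using coset_props(2) [OF a F mem] mem by (metis lessThan_iff)
    then have "syndrome a (d z) = syndrome a (d z')"
      by (metis syndrome_xor xor_left_self)
    then show "z = z'" using d z by simp
  qed
  then have "card (F ` {..<2 ^ bpar a}) = card (cosets a)"
    by (simp add: card_image card)
  \<comment> \<open>A positive cardinality excludes an infinite set, whose \<open>card\<close> is
    0.\<close>
  moreover have "finite (cosets a)" using card by (intro card_ge_0_finite) simp
  ultimately have "F ` {..<2 ^ bpar a} = cosets a"
    using F by (intro card_subset_eq) auto
  then obtain z where z: "z < 2 ^ bpar a" "A = F z" using A by auto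
  show ?thesis
  proof (rule ex1I [of _ "xor c (d z)"])
    show "xor c (d z) \<in> A \<and> in_support a (par a c) (xor (xor c (d z)) c)"
      using mem [of z] z d [OF z(1)] by (simp add: xor.commute [of _ c])
  next
    fix r assume r: "r \<in> A \<and> in_support a (par a c) (xor r c)"
    then have "syndrome a r = syndrome a (xor c (d z))"
      using coset_props(2) [OF a A] mem [of z] z by blast
    then have "syndrome a (xor r c) = syndrome a (d z)"
      by (metis syndrome_xor xor.commute xor_left_self)
    then have "xor r c = d z"
      using syndrome_inj_on_support [OF a] r d [OF z(1)] by blast
    then show "r = xor c (d z)" by (metis xor.commute xor_left_self)
  qed
qed

section \<open>Assembly of \<open>L\<close>\<close>

lemma sum_lessThan_mult: "(\<Sum>k<n * N. f k) = (\<Sum>i<n. \<Sum>p<N. f (i * N + p))"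
  for f :: "nat \<Rightarrow> 'a :: comm_monoid_add"
proof (induction n)
  case (Suc n)
  have "(\<Sum>k<Suc n * N. f k) = (\<Sum>k<n * N + N. f k)" by (simp add: add.commute)
  then show ?case by (simp only: sum_lessThan_add Suc.IH) (simp add: add.commute)
qed simp

lemma bpar_le: "a \<ge> 1 \<Longrightarrow> bpar a \<le> a"
  using bpar_bounds(1) [of a] less_exp [of "bpar a - 1"] by linarith

theorem mainTheorem5:
  fixes a :: nat and C :: "nat \<Rightarrow> nat set" and rho :: "nat \<Rightarrow> nat \<Rightarrow> nat"
    and H :: "nat \<Rightarrow> nat \<Rightarrow> real"
  assumes "a \<ge> 1"
    and "bij_betw C {..<2 ^ bpar a} (cosets a)"
    and "\<forall>i<2 ^ bpar a. bij_betw (rho i) {..<2 ^ (a - bpar a)} (C i)"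
    and "hadamard (2 ^ (a - bpar a)) H"
  shows "cis_cod (2 ^ a) (2 ^ a) (a + 1) (Ldes a rho H)
       \<and> (\<forall>r<2 ^ a. \<forall>c<2 ^ a. Ldes a rho H r c \<noteq> (\<lambda>x. 0))"
proof -
  note a = assms(1)
  define N :: nat where "N = 2 ^ (a - bpar a)"
  have N: "N > 0" by (simp add: N_def)
  have aN: "2 ^ a = 2 ^ bpar a * N"
    using bpar_le [OF a] by (simp add: N_def flip: power_add)
  have card: "card (cosets a) = 2 ^ bpar a"
    using bij_betw_same_card [OF assms(2)] by simp
  have C: "C i \<in> cosets a" if "i < 2 ^ bpar a" for i
    using assms(2) that by (auto simp: bij_betw_def)
  have rho: "bij_betw (rho i) {..<N} (C i)" if "i < 2 ^ bpar a" for i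
    using assms(3) that by (simp add: N_def)
  have H1: "H p q = 1 \<or> H p q = -1" if "p < N" "q < N" for p q
    using assms(4) that by (auto simp: hadamard_def N_def)
  \<comment> \<open>The definition of a Hadamard matrix speaks of rows; multiplication by
    \<open>H\<close> from the left needs orthogonal columns.\<close>
  have "(\<Sum>k<N. H p k * H q k) = (if p = q then real N else 0)" if "p < N" "q < N" for p q
    using assms(4) that by (simp add: hadamard_def N_def)
  note HH = transpose_orthogonal [of N H, OF this]
  have L: "Ldes a rho H r c x = of_real (1 / sqrt N) *
      (\<Sum>q<N. of_real (H (r mod N) q) * Kdes a (rho (r div N) q) c x)" for r c x
    by (simp add: Ldes_def Let_def N_def)

  have entry: "cis_entry (a + 1) (Ldes a rho H r c)" if r: "r < 2 ^ a" and c: "c < 2 ^ a" for r c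
  proof -
    have i: "r div N < 2 ^ bpar a" using r by (simp add: aN less_mult_imp_div_less)
    have p: "r mod N < N" using N by simp
    obtain t where t: "t \<in> C (r div N)" "in_support a (par a c) (xor t c)"
      and t': "\<forall>s. s \<in> C (r div N) \<and> in_support a (par a c) (xor s c) \<longrightarrow> s = t"
      using coset_meets_support [OF a card C [OF i] c] by (elim ex1E conjE)
    have uniq: "s = t" if "s \<in> C (r div N)" "in_support a (par a c) (xor s c)" for s
      by (rule t' [rule_format, OF conjI [OF that]])
    have "t \<in> rho (r div N) ` {..<N}"
      using t(1) bij_betw_imp_surj_on [OF rho [OF i]] by simp
    then obtain q where q: "q < N" "rho (r div N) q = t"
      by (elim imageE) (simp add: that)
    have mem: "rho (r div N) q' \<in> C (r div N)" if "q' < N" for q'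
      using bij_betwE [OF rho [OF i]] that by simp
    \<comment> \<open>\<open>rho\<close> enumerates the coset injectively, so among the rows
      combined by \<open>H\<close> only the one numbered \<open>q\<close> is nonzero in column
      \<open>c\<close>.\<close>
    have zero: "Kdes a (rho (r div N) q') c x = 0" if "q' < N" "q' \<noteq> q" for q' x
    proof -
      have "rho (r div N) q' \<noteq> t"
        using inj_onD [OF bij_betw_imp_inj_on [OF rho [OF i]], of q' q] that q by auto
      then have "\<not> in_support a (par a c) (xor (rho (r div N) q') c)"
        using uniq mem [OF that(1)] by blast
      then show ?thesis
        using Kdes_support [OF a coset_props(1) [OF a C [OF i] mem [OF that(1)]] c] by simp
    qed
    have "Ldes a rho H r c x = of_real (H (r mod N) q / sqrt (2 ^ (a - bpar a))) * Kdes a t c x" for x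
    proof -
      have "(\<Sum>q'<N. of_real (H (r mod N) q') * Kdes a (rho (r div N) q') c x) =
          of_real (H (r mod N) q) * Kdes a t c x"
        using q zero by (subst sum.remove [of _ q]) auto
      then show ?thesis by (simp add: L N_def)
    qed
    moreover have "cis_entry (a + 1) (Kdes a t c)"
      using Kdes_support [OF a coset_props(1) [OF a C [OF i] t(1)] c] t(2) by simp
    ultimately show ?thesis
      using cis_entry_scale [OF _ H1 [OF p q(1)]] by (simp add: cis_entry_def)
  qed

  have orth: "(\<Sum>k<2 ^ a. cnj (Ldes a rho H k i x) * Ldes a rho H k j x) =
      (if i = j then complex_of_real (\<Sum>l\<in>{1..a + 1}. (cmod (x l))\<^sup>2) else 0)"
    if i: "i < 2 ^ a" and j: "j < 2 ^ a" for i j x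
  proof -
    define g where "g r = cnj (Kdes a r i x) * Kdes a r j x" for r
    \<comment> \<open>On the rows of one coset \<open>H\<close> divided by \<open>sqrt N\<close> is
      an isometry, so these rows of \<open>L\<close> contribute what the coset's rows of
      \<open>K\<close> do.\<close>
    have block: "(\<Sum>p<N. cnj (Ldes a rho H (k * N + p) i x) * Ldes a rho H (k * N + p) j x) = sum g (C k)"
      if k: "k < 2 ^ bpar a" for k
    proof -
      have Lk: "Ldes a rho H (k * N + p) c x = of_real (1 / sqrt N) *
         (\<Sum>q<N. of_real (H p q) * Kdes a (rho k q) c x)" if "p < N" for p c
        using that by (simp add: L)
      have "(\<Sum>p<N. cnj (Ldes a rho H (k * N + p) i x) * Ldes a rho H (k * N + p) j x) =
         (\<Sum>p<N. of_real (1 / N) * (cnj (\<Sum>q<N. of_real (H p q) * Kdes a (rho k q) i x) *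
            (\<Sum>q<N. of_real (H p q) * Kdes a (rho k q) j x)))"
      proof (intro sum.cong refl)
        fix p assume "p \<in> {..<N}"
        have "complex_of_real (1 / sqrt N) * complex_of_real (1 / sqrt N) = of_real (1 / N)"
          unfolding of_real_mult [symmetric] by simp
        then have "cnj (of_real (1 / sqrt N) * A) * (of_real (1 / sqrt N) * B) = of_real (1 / N) * (cnj A * B)" for A B
          by (simp only: complex_cnj_mult complex_cnj_complex_of_real) (metis mult.assoc mult.left_commute)
        then show "cnj (Ldes a rho H (k * N + p) i x) * Ldes a rho H (k * N + p) j x =
          of_real (1 / N) * (cnj (\<Sum>q<N. of_real (H p q) * Kdes a (rho k q) i x) *
            (\<Sum>q<N. of_real (H p q) * Kdes a (rho k q) j x))"
          using \<open>p \<in> {..<N}\<close> by (simp only: Lk lessThan_iff)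
      qed
      also have "\<dots> = of_real (1 / N) * (of_real N * (\<Sum>q<N. cnj (Kdes a (rho k q) i x) * Kdes a (rho k q) j x))"
        unfolding sum_distrib_left [symmetric] by (subst sum_cnj_isometry [OF HH]) auto
      also have "\<dots> = (\<Sum>q<N. g (rho k q))"
        using N by (simp add: g_def)
      also have "\<dots> = sum g (C k)"
        by (rule sum.reindex_bij_betw [OF rho [OF k]])
      finally show ?thesis .
    qed
    \<comment> \<open>The cosets partition the row indices, so the block sums add up to the full
      inner product of two columns of \<open>K\<close>.\<close>
    have "(\<Sum>k<2 ^ a. cnj (Ldes a rho H k i x) * Ldes a rho H k j x) = (\<Sum>k<2 ^ bpar a. sum g (C k))"
      unfolding aN sum_lessThan_mult by (intro sum.cong refl block) simp
    also have "\<dots> = (\<Sum>A\<in>cosets a. sum g A)"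
      by (rule sum.reindex_bij_betw [OF assms(2)])
    also have "\<dots> = sum g (\<Union> (cosets a))"
    proof -
      have "sum g (\<Union> (cosets a)) = (sum \<circ> sum) g (cosets a)"
      proof (rule sum.Union_disjoint)
        show "\<forall>A\<in>cosets a. finite A"
          using Union_cosets [OF a] by (metis Union_upper finite_lessThan finite_subset)
        show "\<forall>A\<in>cosets a. \<forall>B\<in>cosets a. A \<noteq> B \<longrightarrow> A \<inter> B = {}"
          using cosets_disjoint by blast
      qed
      then show ?thesis by simp
    qed
    also have "\<dots> = (if i = j then complex_of_real (\<Sum>l\<in>{1..a + 1}. (cmod (x l))\<^sup>2) else 0)"
      unfolding Union_cosets [OF a] g_def by (rule Kdes_orthogonal [OF a i j])
    finally show ?thesis .
  qed

  show ?thesis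
    unfolding cis_cod_def
    by (intro conjI allI impI) (simp_all only: orth entry cis_entry_nonzero [OF entry] simp_thms)
qed

end
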